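(* Let $\mathcal{S}=(S,\cdot,{}^* )$ be an involution semigroup, and suppose that there exist integers $q,r\ge1$ such that the multiplicative reduct $(S,\cdot)$ satisfies the identities $\mathbf v_{n,q}^{(r)}=(\mathbf v_{n,q}^{(r)})^2$ for all $n\ge2$. If all identities of $\mathcal{S}$ (of type $(2,1)$) hold in the involution semigroup $(B_2^1,\cdot,{}^{-1})$, then the identities of $\mathcal{S}$ admit no finite basis.
   Context: An involution semigroup is an algebra $(S,\cdot,{}^* )$ of type $(2,1)$ whose binary operation is associative and whose unary operation satisfies $(xy)^*=y^*x^*$ and $(x^* )^*=x$. $(B_2^1,\cdot,{}^{-1})$ is the involution semigroup whose carrier consists of the six zero-one $2\times2$ matrices $$\begin{pmatrix}0&0\\0&0\end{pmatrix},\ \begin{pmatrix}1&0\\0&1\end{pmatrix},\ \begin{pmatrix}0&1\\0&0\end{pmatrix},\ \begin{pmatrix}0&0\\1&0\end{pmatrix},\ \begin{pmatrix}1&0\\0&0\end{pmatrix},\ \begin{pmatrix}0&0\\0&1\end{pmatrix},$$ with the usual matrix multiplication; the unary operation ${}^{-1}$ is matrix transposition. The words $\mathbf v_{n,m}^{(h)}$: for $i,h\ge1$ let $X_i^{(h)}:=\{x_{i_1i_2\cdots i_h}\mid i_1,\dots,i_h\in\{1,\dots,i\}\}$ be a set of variables. For $n,m\ge1$, the word $\mathbf v_{n,m}^{(h)}$ over $X_{2n}^{(h)}$ is defined by induction on $h\ge1$: $$\mathbf v_{n,m}^{(1)}:=x_1x_2\cdots x_{2n}\,\bigl(x_nx_{n-1}\cdots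 x_1\cdot x_{n+1}x_{n+2}\cdots x_{2n}\bigr)^{2m-1},$$ and for $h>1$, $$\mathbf v_{n,m}^{(h)}:=\mathbf v_{n,m,1}^{(h-1)}\cdots\mathbf v_{n,m,2n}^{(h-1)}\bigl(\mathbf v_{n,m,n}^{(h-1)}\cdots\mathbf v_{n,m,1}^{(h-1)}\cdot \mathbf v_{n,m,n+1}^{(h-1)}\cdots\mathbf v_{n,m,2n}^{(h-1)}\bigr)^{2m-1},$$ where $\mathbf v_{n,m,j}^{(h-1)}$ is obtained from $\mathbf v_{n,m}^{(h-1)}$ by replacing each variable $x_{i_1\dots i_{h-1}}$ by $x_{i_1\dots i_{h-1}j}$. A basis for the identities of an algebra $\mathcal{A}$ is a set $\Sigma$ of identities holding in $\mathcal{A}$ (in the signature of $\mathcal{A}$) such that every algebra of the same type satisfying $\Sigma$ satisfies all identities of $\mathcal{A}$. The identities of $\mathcal{A}$ admit a finite basis if there is a finite such $\Sigma$. *)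

theory Defs
  imports "HOL-Analysis.Cartesian_Space" "HOL-Library.Countable" "HOL-Library.Infinite_Typeclass"
begin

section \<open>Algebras of type (2,1), terms and identities\<close>

record 'a algebra21 =
  carrier :: "'a set"
  mult :: "'a \<Rightarrow> 'a \<Rightarrow> 'a"
  star :: "'a \<Rightarrow> 'a"

definition algebra21 :: "'a algebra21 \<Rightarrow> bool" where
  "algebra21 A \<longleftrightarrow>
     carrier A \<noteq> {} \<and>
     (\<forall>x\<in>carrier A. \<forall>y\<in>carrier A. mult A x y \<in> carrier A) \<and>
     (\<forall>x\<in>carrier A. star A x \<in> carrier A)"

definition involution_semigroup :: "'a algebra21 \<Rightarrow> bool" where
  "involution_semigroup A \<longleftrightarrow>
     algebra21 A \<and>
     (\<forall>x\<in>carrier A. \<forall>y\<in>carrier A. \<forall>z\<in>carrier A.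
        mult A (mult A x y) z = mult A x (mult A y z)) \<and>
     (\<forall>x\<in>carrier A. \<forall>y\<in>carrier A. star A (mult A x y) = mult A (star A y) (star A x)) \<and>
     (\<forall>x\<in>carrier A. star A (star A x) = x)"

datatype 'v uterm = Var 'v | Mult "'v uterm" "'v uterm" | Star "'v uterm"

instance uterm :: (countable) countable
  by countable_datatype

primrec eval :: "'a algebra21 \<Rightarrow> ('v \<Rightarrow> 'a) \<Rightarrow> 'v uterm \<Rightarrow> 'a" where
  "eval A \<phi> (Var x) = \<phi> x"
| "eval A \<phi> (Mult s t) = mult A (eval A \<phi> s) (eval A \<phi> t)"
| "eval A \<phi> (Star t) = star A (eval A \<phi> t)"

type_synonym 'v identity = "'v uterm \<times> 'v uterm"

definition satisfies :: "'a algebra21 \<Rightarrow> 'v identity \<Rightarrow> bool" where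
  "satisfies A e \<longleftrightarrow>
     (\<forall>\<phi>. (\<forall>x. \<phi> x \<in> carrier A) \<longrightarrow> eval A \<phi> (fst e) = eval A \<phi> (snd e))"

text \<open>Identities are written over the countably infinite alphabet of variables indexed by
  natural numbers.\<close>

definition identities :: "'a algebra21 \<Rightarrow> nat identity set" where
  "identities A = {e. satisfies A e}"

text \<open>HOL cannot quantify over all types inside a definition, so the algebras that a basis is
  tested on have a subset of some infinite type \<open>'b\<close> as carrier. This is no restriction: see
  \<open>is_basis_universal\<close> below, where \<open>'c\<close> is arbitrary.\<close>

definition is_basis :: "'b::infinite itself \<Rightarrow> nat identity set \<Rightarrow> 'a algebra21 \<Rightarrow> bool" where
  "is_basis _ \<Sigma> A \<longleftrightarrow>
     \<Sigma> \<subseteq> identities A \<and>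
     (\<forall>B :: 'b algebra21. algebra21 B \<and> \<Sigma> \<subseteq> identities B \<longrightarrow> identities A \<subseteq> identities B)"

definition finitely_based :: "'b::infinite itself \<Rightarrow> 'a algebra21 \<Rightarrow> bool" where
  "finitely_based T A \<longleftrightarrow> (\<exists>\<Sigma>. finite \<Sigma> \<and> is_basis T \<Sigma> A)"

lemma eval_closed:
  assumes "algebra21 A" "\<forall>x. \<phi> x \<in> carrier A"
  shows "eval A \<phi> t \<in> carrier A"
  using assms by (induction t) (auto simp: algebra21_def)

primrec subst :: "('w \<Rightarrow> 'v uterm) \<Rightarrow> 'w uterm \<Rightarrow> 'v uterm" where
  "subst \<sigma> (Var x) = \<sigma> x"
| "subst \<sigma> (Mult s t) = Mult (subst \<sigma> s) (subst \<sigma> t)"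
| "subst \<sigma> (Star t) = Star (subst \<sigma> t)"

lemma eval_subst: "eval A \<phi> (subst \<sigma> t) = eval A (\<lambda>x. eval A \<phi> (\<sigma> x)) t"
  by (induction t) auto

lemma is_basis_universal:
  fixes A :: "'a algebra21" and B :: "'c algebra21"
  assumes basis: "is_basis TYPE('b::infinite) \<Sigma> A"
    and B: "algebra21 B" "\<Sigma> \<subseteq> identities B"
  shows "identities A \<subseteq> identities B"
proof
  fix e assume e: "e \<in> identities A"
  have "eval B \<phi> (fst e) = eval B \<phi> (snd e)" if \<phi>: "\<forall>x. \<phi> x \<in> carrier B" for \<phi>
  proof -
    define C where "C = range (eval B \<phi>)"
    obtain g :: "nat \<Rightarrow> 'b" where g: "inj g"
      using infinite_countable_subset[OF infinite_UNIV] by blast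
    define f where "f = (\<lambda>c. g (to_nat_on C c))"
    have "countable C" unfolding C_def by simp
    then have f: "inj_on f C"
      unfolding f_def using g by (intro inj_onI) (simp add: inj_eq)
    define h where "h = inv_into C f"
    have hf: "h (f c) = c" if "c \<in> C" for c
      unfolding h_def using f that by simp
    have Cm: "mult B c d \<in> C" if "c \<in> C" "d \<in> C" for c d
      using that unfolding C_def by (auto simp flip: eval.simps)
    have Cs: "star B c \<in> C" if "c \<in> C" for c
      using that unfolding C_def by (auto simp flip: eval.simps)
    define D where "D = \<lparr>carrier = f ` C, mult = (\<lambda>x y. f (mult B (h x) (h y))),
      star = (\<lambda>x. f (star B (h x)))\<rparr>"
    have D: "algebra21 D"
      unfolding algebra21_def D_def using Cm Cs hf by (auto simp: C_def)
    have ev: "eval B (\<lambda>x. h (\<psi> x)) t \<in> C \<and> eval D \<psi> t = f (eval B (\<lambda>x. h (\<psi> x)) t)"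
      if \<psi>: "\<forall>x. \<psi> x \<in> carrier D" for \<psi> :: "nat \<Rightarrow> 'b" and t
    proof (induction t)
      case (Var x)
      then show ?case using \<psi>[rule_format, of x] hf by (auto simp: D_def)
    qed (use Cm Cs hf in \<open>auto simp: D_def\<close>)
    have "\<Sigma> \<subseteq> identities D"
    proof
      fix s assume "s \<in> \<Sigma>"
      then have s: "satisfies B s" using B(2) by (auto simp: identities_def)
      have "eval D \<psi> (fst s) = eval D \<psi> (snd s)" if \<psi>: "\<forall>x. \<psi> x \<in> carrier D" for \<psi>
      proof -
        have "h (\<psi> x) \<in> carrier B" for x
          using \<psi>[rule_format, of x] hf eval_closed[OF B(1) \<phi>] by (auto simp: D_def C_def)
        then show ?thesis using s ev[OF \<psi>] by (simp add: satisfies_def)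
      qed
      then show "s \<in> identities D" by (simp add: identities_def satisfies_def)
    qed
    with basis D e have sat: "satisfies D e"
      unfolding is_basis_def by (auto simp: identities_def)
    have \<phi>C: "\<phi> x \<in> C" for x
      unfolding C_def by (metis eval.simps(1) rangeI)
    have fD: "\<forall>x. f (\<phi> x) \<in> carrier D"
      using \<phi>C by (auto simp: D_def)
    have "eval D (\<lambda>x. f (\<phi> x)) (fst e) = eval D (\<lambda>x. f (\<phi> x)) (snd e)"
      using sat fD by (simp add: satisfies_def)
    then have "f (eval B \<phi> (fst e)) = f (eval B \<phi> (snd e))"
      using ev[OF fD] by (simp add: hf \<phi>C)
    then show ?thesis
      using f by (auto simp: inj_on_def C_def)
  qed
  then show "e \<in> identities B" by (simp add: identities_def satisfies_def)
qed

section \<open>Semigroup words\<close>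

text \<open>A semigroup word is a nonempty list of variables. The product is bracketed to the right,
  which is immaterial in a semigroup. The value of the empty list is irrelevant.\<close>

fun word_eval :: "'a algebra21 \<Rightarrow> ('v \<Rightarrow> 'a) \<Rightarrow> 'v list \<Rightarrow> 'a" where
  "word_eval A \<phi> [] = undefined"
| "word_eval A \<phi> [x] = \<phi> x"
| "word_eval A \<phi> (x # y # w) = mult A (\<phi> x) (word_eval A \<phi> (y # w))"

definition reduct_satisfies :: "'a algebra21 \<Rightarrow> 'v list \<Rightarrow> 'v list \<Rightarrow> bool" where
  "reduct_satisfies A u w \<longleftrightarrow>
     (\<forall>\<phi>. (\<forall>x. \<phi> x \<in> carrier A) \<longrightarrow> word_eval A \<phi> u = word_eval A \<phi> w)"

text \<open>The word \<open>w\<^sub>1\<dots>w\<^bsub>2n\<^esub> (w\<^sub>n\<dots>w\<^sub>1 \<cdot> w\<^bsub>n+1\<^esub>\<dots>w\<^bsub>2n\<^esub>)\<^bsup>2m-1\<^esup>\<close>.\<close>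

definition v_pattern :: "nat \<Rightarrow> nat \<Rightarrow> (nat \<Rightarrow> 'v list) \<Rightarrow> 'v list" where
  "v_pattern n m w =
     concat (map w [1..<2 * n + 1]) @
     concat (replicate (2 * m - 1)
       (concat (map w (rev [1..<n + 1])) @ concat (map w [n + 1..<2 * n + 1])))"

text \<open>\<open>v_word n m h\<close> is the word $\mathbf v_{n,m}^{(h)}$; its variable $x_{i_1\dots i_h}$ is
  represented by the list \<open>[i\<^sub>1, \<dots>, i\<^sub>h]\<close>. The case \<open>h = 0\<close> is a dummy.\<close>

fun v_word :: "nat \<Rightarrow> nat \<Rightarrow> nat \<Rightarrow> nat list list" where
  "v_word n m 0 = []"
| "v_word n m (Suc 0) = v_pattern n m (\<lambda>j. [[j]])"
| "v_word n m (Suc (Suc h)) =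
     v_pattern n m (\<lambda>j. map (\<lambda>i. i @ [j]) (v_word n m (Suc h)))"

section \<open>The involution semigroup $(B_2^1,\cdot,{}^{-1})$\<close>

definition B21 :: "(int^2^2) algebra21" where
  "B21 = \<lparr>
     carrier =
       {vector [vector [0, 0], vector [0, 0]],
        vector [vector [1, 0], vector [0, 1]],
        vector [vector [0, 1], vector [0, 0]],
        vector [vector [0, 0], vector [1, 0]],
        vector [vector [1, 0], vector [0, 0]],
        vector [vector [0, 0], vector [0, 1]]},
     mult = (\<lambda>X Y. X ** Y),
     star = transpose\<rparr>"

end

theory Submission
  imports Defs
begin

text \<open>For a finite set of identities of $\mathcal S$ that mention few variables we construct an algebra
  of partial injections which satisfies them, because every small set of its elements already
  satisfies all identities of $B_2^1$, but in which $\mathbf v_{n,q}^{(r)}$ takes a value that moves one point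
  to another point, is undefined there, and hence is not idempotent.

  Take the elements of $B_2^1$ as partial injections of a two-element set. A map from the underlying
  set to two points is compatible with a set of partial injections if it turns each of them into an
  element of $B_2^1$. If the compatible maps separate points and also detect undefinedness, then all
  identities of $B_2^1$ hold under assignments into this set. The algebras come from the path labelled
  by $\mathbf v_{n,m}^{(1)}$, whose edges with equal labels are identified as one partial injection, by
  substituting the graph for its own edges $r$ times. Almost all pairs of points are
  separated by compatible maps that handle every letter; the exception, the start and the end of
  the path, needs one letter $x_j$ that is not used, and this is available on each level as soon as
  fewer than $n$ elements are considered.\<close>

section \<open>Cuts of a set of partial maps\<close>

text \<open>Why the two ends of the path are special: copies with one label are treated alike if the
  corresponding edges are both contracted by the colouring or both crossed in the same direction.
  The second occurrence of the letter x_i runs from \<open>n + i\<close> back to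
  \<open>n + i - 1\<close>. A colouring of the path that respects every label therefore changes
  colour between \<open>i - 1\<close> and \<open>i\<close> exactly if it does so between
  \<open>n + i - 1\<close> and \<open>n + i\<close>. Summing modulo 2, the colours of
  \<open>0\<close> and \<open>n\<close> differ exactly if those of \<open>n\<close> and
  \<open>2 * n\<close> do, so \<open>0\<close> and \<open>2 * n\<close> always get the same colour.
  A colouring that separates them has to violate some label, and it may do so at a label in whose
  copies no element acts.\<close>

definition rel_image :: "('v \<Rightarrow> 'w) \<Rightarrow> 'v rel \<Rightarrow> 'w rel" where
  "rel_image f \<alpha> = map_prod f f ` \<alpha>"

definition thin :: "'v rel set" where
  "thin = {\<alpha>. \<alpha> = {} \<or> (\<exists>a b. \<alpha> = {(a, b)})}"

text \<open>These are the six matrices read as relations on two points: the zero matrix and the four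
  matrix units are thin, and \<open>Id\<close> is the unit matrix.\<close>

definition B21_rel :: "bool rel set" where
  "B21_rel = insert Id thin"

definition cut :: "'v rel set \<Rightarrow> ('v \<Rightarrow> bool) \<Rightarrow> bool" where
  "cut E f \<longleftrightarrow> (\<forall>\<alpha>\<in>E. rel_image f \<alpha> \<in> B21_rel)"

definition rel_algebra :: "'v rel set \<Rightarrow> 'v rel algebra21" where
  "rel_algebra T = \<lparr>carrier = T, mult = (O), star = converse\<rparr>"

lemma rel_algebra_simps [simp]:
  "carrier (rel_algebra T) = T" "mult (rel_algebra T) = (O)" "star (rel_algebra T) = converse"
  by (simp_all add: rel_algebra_def)

lemma rel_imageI: "(x, y) \<in> \<alpha> \<Longrightarrow> (f x, f y) \<in> rel_image f \<alpha>"
  by (force simp: rel_image_def)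

lemma rel_image_converse: "rel_image f (\<alpha>\<inverse>) = (rel_image f \<alpha>)\<inverse>"
  by (auto simp: rel_image_def)

lemma Domain_rel_image: "Domain (rel_image f \<alpha>) = f ` Domain \<alpha>"
  by (force simp: rel_image_def)

lemma thin_empty [simp]: "{} \<in> thin" and thin_single [simp]: "{(a, b)} \<in> thin"
  by (auto simp: thin_def)

lemma thinI:
  assumes "\<And>p p'. p \<in> \<alpha> \<Longrightarrow> p' \<in> \<alpha> \<Longrightarrow> p = p'"
  shows "\<alpha> \<in> thin"
proof (cases "\<alpha> = {}")
  case False
  then obtain a b where "(a, b) \<in> \<alpha>" by auto
  then have "\<alpha> = {(a, b)}" using assms by blast
  then show ?thesis by simp
qed simp

lemma thinD: "\<alpha> \<in> thin \<Longrightarrow> p \<in> \<alpha> \<Longrightarrow> p' \<in> \<alpha> \<Longrightarrow> p = p'"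
  by (auto simp: thin_def)

lemma rel_image_thin: "\<alpha> \<in> thin \<Longrightarrow> rel_image f \<alpha> \<in> thin"
  by (auto simp: thin_def rel_image_def)

lemma rel_image_thin_B21: "\<alpha> \<in> thin \<Longrightarrow> rel_image f \<alpha> \<in> B21_rel"
  unfolding B21_rel_def using rel_image_thin by (rule insertI2)

lemma thin_Domain: "\<alpha> \<in> thin \<Longrightarrow> \<exists>b. Domain \<alpha> \<subseteq> {b}"
  by (auto simp: thin_def)

lemma Id_bool_not_thin: "(Id :: bool rel) \<notin> thin"
  using thinD[of Id "(True, True)" "(False, False)"] by auto

lemma thin_converse: "\<alpha>\<inverse> \<in> thin \<longleftrightarrow> \<alpha> \<in> thin"
proof -
  have "\<beta>\<inverse> \<in> thin" if "\<beta> \<in> thin" for \<beta> :: "'a rel"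
    using that by (auto simp: thin_def)
  from this[of \<alpha>] this[of "\<alpha>\<inverse>"] show ?thesis
    unfolding converse_converse by (rule iffI[rotated])
qed

lemma B21_rel_converse: "\<alpha>\<inverse> \<in> B21_rel \<longleftrightarrow> \<alpha> \<in> B21_rel"
proof -
  have "\<alpha>\<inverse> = Id \<longleftrightarrow> \<alpha> = Id"
    using converse_inject[of \<alpha> Id] unfolding converse_Id .
  then show ?thesis by (simp add: B21_rel_def thin_converse)
qed

lemma B21_rel_comp: "\<alpha> \<in> B21_rel \<Longrightarrow> \<beta> \<in> B21_rel \<Longrightarrow> \<alpha> O \<beta> \<in> B21_rel"
proof -
  assume \<alpha>: "\<alpha> \<in> B21_rel" and \<beta>: "\<beta> \<in> B21_rel"
  have "\<alpha> O \<beta> \<in> thin" if "\<alpha> \<in> thin" "\<beta> \<in> thin"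
  proof (rule thinI)
    fix p p' assume "p \<in> \<alpha> O \<beta>" "p' \<in> \<alpha> O \<beta>"
    then obtain x y z x' y' z' where *: "p = (x, z)" "(x, y) \<in> \<alpha>" "(y, z) \<in> \<beta>"
      "p' = (x', z')" "(x', y') \<in> \<alpha>" "(y', z') \<in> \<beta>"
      by blast
    then show "p = p'"
      using thinD[OF that(1) *(2) *(5)] thinD[OF that(2) *(3) *(6)] by simp
  qed
  then show ?thesis using \<alpha> \<beta> unfolding B21_rel_def by fastforce
qed

lemma algebra21_B21_rel: "algebra21 (rel_algebra B21_rel)"
proof -
  have "B21_rel \<noteq> {}" by (simp add: B21_rel_def)
  then show ?thesis by (simp add: algebra21_def B21_rel_comp B21_rel_converse)
qed

lemma thin_single_valued: "\<alpha> \<in> thin \<Longrightarrow> single_valued \<alpha>"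
  by (auto simp: single_valued_def thin_def)

lemma B21_rel_single_valued: "\<alpha> \<in> B21_rel \<Longrightarrow> single_valued \<alpha>"
  unfolding B21_rel_def using thin_single_valued single_valued_Id by blast

lemma B21_rel_converse_single_valued: "\<alpha> \<in> B21_rel \<Longrightarrow> single_valued (\<alpha>\<inverse>)"
  by (rule B21_rel_single_valued) (simp add: B21_rel_converse)

lemma B21_rel_cases:
  assumes "\<alpha> \<in> B21_rel"
  obtains "\<alpha> = {}" | "\<alpha> = Id" | "\<alpha> = {(True, True)}" | "\<alpha> = {(True, False)}"
    | "\<alpha> = {(False, True)}" | "\<alpha> = {(False, False)}"
proof -
  from assms consider "\<alpha> = {}" | "\<alpha> = Id" | a b where "\<alpha> = {(a, b)}"
    unfolding B21_rel_def thin_def by blast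
  then show ?thesis
  proof cases
    case (3 a b)
    then show ?thesis using that by (cases a; cases b) simp_all
  qed (use that in simp_all)
qed

section \<open>Relations on two points as matrices, and transfer of identities from B_2^1\<close>

definition rel_matrix :: "bool rel \<Rightarrow> int^2^2" where
  "rel_matrix \<alpha> = (\<chi> i j. of_bool ((i = 1, j = 1) \<in> \<alpha>))"

lemma rel_matrix_in_B21: "\<alpha> \<in> B21_rel \<Longrightarrow> rel_matrix \<alpha> \<in> carrier B21"
  by (erule B21_rel_cases) (simp_all add: B21_def rel_matrix_def vec_eq_iff forall_2)

lemma rel_matrix_converse: "rel_matrix (\<alpha>\<inverse>) = transpose (rel_matrix \<alpha>)"
  by (simp add: rel_matrix_def transpose_def)

lemma relcomp_bool_iff:
  "(a, c) \<in> \<alpha> O \<beta> \<longleftrightarrow> (a, True) \<in> \<alpha> \<and> (True, c) \<in> \<beta> \<or> (a, False) \<in> \<alpha> \<and> (False, c) \<in> \<beta>"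
  by (simp add: relcomp_unfold ex_bool_eq)

text \<open>A row of a matrix in B_2^1 has at most one entry 1, so no entry of the integer product
  exceeds 1 and the product describes the composite relation, whatever \<open>\<beta>\<close>
  is.\<close>

lemma rel_matrix_relcomp:
  "\<alpha> \<in> B21_rel \<Longrightarrow> rel_matrix (\<alpha> O \<beta>) = rel_matrix \<alpha> ** rel_matrix \<beta>"
  by (erule B21_rel_cases)
    (simp_all add: rel_matrix_def matrix_matrix_mult_def vec_eq_iff forall_2 sum_2 relcomp_bool_iff)

lemma rel_matrix_inject: "rel_matrix \<alpha> = rel_matrix \<beta> \<Longrightarrow> \<alpha> = \<beta>"
proof -
  assume "rel_matrix \<alpha> = rel_matrix \<beta>"
  then have "(a, b) \<in> \<alpha> \<longleftrightarrow> (a, b) \<in> \<beta>" for a b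
    by (cases a; cases b) (auto simp: rel_matrix_def vec_eq_iff forall_2)
  then show ?thesis by auto
qed

lemma B21_ops: "mult B21 = (**)" "star B21 = transpose"
  by (simp_all add: B21_def fun_eq_iff)

lemma identities_B21_rel: "identities B21 \<subseteq> identities (rel_algebra B21_rel)"
proof
  fix e assume "e \<in> identities B21"
  then have e: "satisfies B21 e" by (simp add: identities_def)
  have "eval (rel_algebra B21_rel) \<psi> (fst e) = eval (rel_algebra B21_rel) \<psi> (snd e)"
    if \<psi>: "\<forall>x. \<psi> x \<in> B21_rel" for \<psi>
  proof -
    have cl: "eval (rel_algebra B21_rel) \<psi> t \<in> B21_rel" for t
      using eval_closed[OF algebra21_B21_rel] \<psi> by simp
    have "eval B21 (\<lambda>x. rel_matrix (\<psi> x)) t = rel_matrix (eval (rel_algebra B21_rel) \<psi> t)" for t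
      by (induction t) (simp_all add: cl rel_matrix_relcomp rel_matrix_converse B21_ops)
    moreover have "eval B21 (\<lambda>x. rel_matrix (\<psi> x)) (fst e) = eval B21 (\<lambda>x. rel_matrix (\<psi> x)) (snd e)"
      using e \<psi> rel_matrix_in_B21 by (simp add: satisfies_def)
    ultimately show ?thesis using rel_matrix_inject by metis
  qed
  then show "e \<in> identities (rel_algebra B21_rel)"
    by (simp add: identities_def satisfies_def)
qed

text \<open>A cut need not induce a homomorphism into $B_2^1$; the image of a product is only contained
  in the product of the images. The second assumption recovers definedness from the cuts, and the
  first one recovers the end point.\<close>

lemma cuts_imp_identity:
  fixes \<phi> :: "nat \<Rightarrow> 'v rel"
  assumes e: "e \<in> identities B21"
    and sep: "\<And>p q. p \<noteq> q \<Longrightarrow> \<exists>f. cut (range \<phi>) f \<and> f p \<noteq> f q"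
    and dom: "\<And>x p. p \<notin> Domain (\<phi> x) \<Longrightarrow>
      \<exists>f. cut (range \<phi>) f \<and> f p \<notin> Domain (rel_image f (\<phi> x))"
    and ran: "\<And>x p. p \<notin> Range (\<phi> x) \<Longrightarrow>
      \<exists>f. cut (range \<phi>) f \<and> f p \<notin> Range (rel_image f (\<phi> x))"
  shows "eval (rel_algebra T) \<phi> (fst e) = eval (rel_algebra T) \<phi> (snd e)"
proof -
  define ev where "ev = eval (rel_algebra T) \<phi>"
  define ev' where "ev' f = eval (rel_algebra B21_rel) (\<lambda>x. rel_image f (\<phi> x))" for f :: "'v \<Rightarrow> bool"
  have ev_simps: "ev (Var x) = \<phi> x" "ev (Mult s t) = ev s O ev t" "ev (Star t) = (ev t)\<inverse>" for x s t
    by (simp_all add: ev_def)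
  have ev'_simps: "ev' f (Var x) = rel_image f (\<phi> x)" "ev' f (Mult s t) = ev' f s O ev' f t"
    "ev' f (Star t) = (ev' f t)\<inverse>" for f x s t
    by (simp_all add: ev'_def)
  have B21: "ev' f t \<in> B21_rel" if "cut (range \<phi>) f" for f t
    unfolding ev'_def using eval_closed[OF algebra21_B21_rel] that by (simp add: cut_def)
  have hom: "(f p, f q) \<in> ev' f t" if "(p, q) \<in> ev t" for f p q t
    using that
  proof (induction t arbitrary: p q)
    case (Mult t\<^sub>1 t\<^sub>2)
    from Mult.prems obtain m where "(p, m) \<in> ev t\<^sub>1" "(m, q) \<in> ev t\<^sub>2"
      by (auto simp: ev_simps)
    then have "(f p, f m) \<in> ev' f t\<^sub>1" "(f m, f q) \<in> ev' f t\<^sub>2"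
      by (auto intro: Mult.IH)
    then show ?case by (auto simp: ev'_simps)
  qed (auto simp: ev_simps ev'_simps intro: rel_imageI)
  have fun_cut: "b = c" if "cut (range \<phi>) f" "(a, b) \<in> ev' f t" "(a, c) \<in> ev' f t" for f t a b c
    using B21_rel_single_valued[OF B21[OF that(1)]] that(2,3) by (auto dest: single_valuedD)
  have inj_cut: "b = c" if "cut (range \<phi>) f" "(b, a) \<in> ev' f t" "(c, a) \<in> ev' f t" for f t a b c
    using B21_rel_converse_single_valued[OF B21[OF that(1)]] that(2,3)
    by (auto dest: single_valuedD)
  \<comment> \<open>Definedness is tested against all cuts at once. In a product, single-valuedness
    of the images (or of their converses) forces the intermediate point in every cut to be the image
    of the same \<open>m\<close>, so the second induction hypothesis applies at \<open>m\<close>.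
    Domain and range go together because \<open>Star\<close> exchanges them.\<close>
  have lift: "((\<forall>f. cut (range \<phi>) f \<longrightarrow> f p \<in> Domain (ev' f t)) \<longrightarrow> p \<in> Domain (ev t)) \<and>
    ((\<forall>f. cut (range \<phi>) f \<longrightarrow> f p \<in> Range (ev' f t)) \<longrightarrow> p \<in> Range (ev t))" for t p
  proof (induction t arbitrary: p)
    case (Var x)
    then show ?case using dom[of p x] ran[of p x] unfolding ev_simps ev'_simps by metis
  next
    case (Mult s t)
    have "p \<in> Domain (ev (Mult s t))"
      if p: "\<forall>f. cut (range \<phi>) f \<longrightarrow> f p \<in> Domain (ev' f s O ev' f t)"
    proof -
      have "\<forall>f. cut (range \<phi>) f \<longrightarrow> f p \<in> Domain (ev' f s)" using p by fastforce
      then obtain m where m: "(p, m) \<in> ev s" using Mult.IH(1) by blast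
      have "f m \<in> Domain (ev' f t)" if f: "cut (range \<phi>) f" for f
      proof -
        obtain b c where bc: "(f p, b) \<in> ev' f s" "(b, c) \<in> ev' f t"
          using p[rule_format, OF f] by auto
        then have "b = f m" using fun_cut[OF f bc(1) hom[OF m]] by simp
        then show ?thesis using bc(2) by auto
      qed
      then have "m \<in> Domain (ev t)" using Mult.IH(2) by blast
      then show ?thesis using m by (auto simp: ev_simps)
    qed
    moreover have "p \<in> Range (ev (Mult s t))"
      if p: "\<forall>f. cut (range \<phi>) f \<longrightarrow> f p \<in> Range (ev' f s O ev' f t)"
    proof -
      have "\<forall>f. cut (range \<phi>) f \<longrightarrow> f p \<in> Range (ev' f t)" using p by fastforce
      then obtain m where m: "(m, p) \<in> ev t" using Mult.IH(2) by blast
      have "f m \<in> Range (ev' f s)" if f: "cut (range \<phi>) f" for f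
      proof -
        obtain b c where bc: "(b, f p) \<in> ev' f t" "(c, b) \<in> ev' f s"
          using p[rule_format, OF f] by auto
        then have "b = f m" using inj_cut[OF f bc(1) hom[OF m]] by simp
        then show ?thesis using bc(2) by auto
      qed
      then have "m \<in> Range (ev s)" using Mult.IH(1) by blast
      then show ?thesis using m by (auto simp: ev_simps)
    qed
    ultimately show ?case unfolding ev'_simps by blast
  next
    case (Star t)
    then show ?case unfolding ev_simps ev'_simps Domain_converse Range_converse by blast
  qed
  have le: "ev u \<subseteq> ev w" if eq: "\<And>f. cut (range \<phi>) f \<Longrightarrow> ev' f u = ev' f w" for u w
  proof clarify
    fix p q assume pq: "(p, q) \<in> ev u"
    have pq': "(f p, f q) \<in> ev' f w" if "cut (range \<phi>) f" for f
      using hom[OF pq, of f] eq[OF that] by simp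
    then have "p \<in> Domain (ev w)" using lift[of p w] by blast
    then obtain r where r: "(p, r) \<in> ev w" by blast
    have "f r = f q" if "cut (range \<phi>) f" for f
      using fun_cut[OF that hom[OF r] pq'[OF that]] .
    then have "r = q" using sep[of r q] by blast
    then show "(p, q) \<in> ev w" using r by simp
  qed
  have "satisfies (rel_algebra B21_rel) e"
    using e identities_B21_rel by (auto simp: identities_def)
  then have "ev' f (fst e) = ev' f (snd e)" if "cut (range \<phi>) f" for f
    using that by (simp add: ev'_def satisfies_def cut_def)
  then show ?thesis
    using le[of "fst e" "snd e"] le[of "snd e" "fst e"] unfolding ev_def by (simp add: subset_antisym)
qed

section \<open>Iterated graphs\<close>

text \<open>The outer path reads $x_1\dots x_n\cdot x_{n+1}\cdots x_{2n}$ from \<open>Out 0\<close> through \<open>Out n\<close> to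
  \<open>Out (2 * n)\<close> and $x_n\dots x_1$ from \<open>Out (2 * n)\<close> back to \<open>Out n\<close>; the factor
  $x_{n+1}\cdots x_{2n}$ is a single edge. Edge \<open>0\<close> is that edge, and the edges \<open>i\<close> and \<open>n + i\<close>
  are the two occurrences of $x_i$. On the next level each edge is replaced by a copy of
  the whole graph: \<open>In \<kappa> v\<close> is the vertex \<open>v\<close> of the copy that replaces edge \<open>\<kappa>\<close>.\<close>

datatype vertex = Out nat | In nat vertex

locale iterated_graph =
  fixes n :: nat
  assumes n3: "3 \<le> n"
begin

text \<open>Edge numbers beyond \<open>2 * n\<close> get labels above \<open>n\<close>, so the
  condition \<open>label \<kappa> \<le> n\<close> selects the actual edges of the graph.\<close>

definition label :: "nat \<Rightarrow> nat" where
  "label \<kappa> = (if \<kappa> \<le> n then \<kappa> else \<kappa> - n)"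

definition src :: "nat \<Rightarrow> nat" where
  "src \<kappa> = (if \<kappa> = 0 then n else if \<kappa> \<le> n then \<kappa> - 1 else \<kappa>)"

definition tgt :: "nat \<Rightarrow> nat" where
  "tgt \<kappa> = (if \<kappa> = 0 then 2 * n else if \<kappa> \<le> n then \<kappa> else \<kappa> - 1)"

abbreviation initial :: vertex where "initial \<equiv> Out 0"
abbreviation final :: vertex where "final \<equiv> Out (2 * n)"

text \<open>The ends of a copy are merged with the ends of the replaced edge. The points
  \<open>In \<kappa> initial\<close> and \<open>In \<kappa> final\<close> are thus spare points in
  no copy.\<close>

definition embed :: "nat \<Rightarrow> vertex \<Rightarrow> vertex" where
  "embed \<kappa> v = (if v = initial then Out (src \<kappa>) else if v = final then Out (tgt \<kappa>) else In \<kappa> v)"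

definition lift :: "nat \<Rightarrow> vertex rel \<Rightarrow> vertex rel" where
  "lift i \<alpha> = {(embed \<kappa> x, embed \<kappa> y) | \<kappa> x y. label \<kappa> = i \<and> (x, y) \<in> \<alpha>}"

text \<open>Thin relations are added on every level because the product of two lifts with different
  labels contains at most one pair; this closes the tower under composition.\<close>

primrec tower :: "nat \<Rightarrow> vertex rel set" where
  "tower 0 = thin"
| "tower (Suc h) = thin \<union> {lift i \<alpha> | i \<alpha>. i \<le> n \<and> \<alpha> \<in> tower h}"

lemma initial_neq_final: "initial \<noteq> final"
  using n3 by simp

lemma src_neq_tgt: "src \<kappa> \<noteq> tgt \<kappa>"
  using n3 by (auto simp: src_def tgt_def)

text \<open>The edges \<open>i\<close> and \<open>n + i\<close> occupy \<open>i - 1, i\<close> and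
  \<open>n + i - 1, n + i\<close>, which are disjoint as \<open>n\<close> exceeds 1. So copies with
  one label do not overlap, and the lift of a partial injection is again one.\<close>

lemma edges_same_label_disjoint:
  assumes "label \<kappa> = label \<mu>" "label \<kappa> \<le> n" "{src \<kappa>, tgt \<kappa>} \<inter> {src \<mu>, tgt \<mu>} \<noteq> {}"
  shows "\<kappa> = \<mu>"
  using assms n3 by (auto simp: label_def src_def tgt_def split: if_splits)

lemma embed_inject:
  assumes "label \<kappa> = label \<mu>" "label \<kappa> \<le> n" "embed \<kappa> x = embed \<mu> y"
  shows "\<kappa> = \<mu>" "x = y"
proof -
  show "\<kappa> = \<mu>"
    using assms edges_same_label_disjoint[OF assms(1,2)] by (auto simp: embed_def split: if_splits)
  then show "x = y"
    using assms(3) src_neq_tgt[of \<mu>] by (auto simp: embed_def split: if_splits)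
qed

lemma lift_iff:
  assumes "label \<kappa> = i" "i \<le> n"
  shows "(embed \<kappa> x, embed \<kappa> y) \<in> lift i \<alpha> \<longleftrightarrow> (x, y) \<in> \<alpha>"
proof
  assume "(embed \<kappa> x, embed \<kappa> y) \<in> lift i \<alpha>"
  then obtain \<mu> x' y' where *: "embed \<kappa> x = embed \<mu> x'" "embed \<kappa> y = embed \<mu> y'"
    "label \<mu> = i" "(x', y') \<in> \<alpha>"
    unfolding lift_def by blast
  then have "x = x'" "y = y'"
    using embed_inject(2)[of \<kappa> \<mu>] assms by auto
  then show "(x, y) \<in> \<alpha>" using *(4) by simp
next
  assume "(x, y) \<in> \<alpha>"
  then show "(embed \<kappa> x, embed \<kappa> y) \<in> lift i \<alpha>"
    unfolding lift_def using assms(1) by blast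
qed

lemma lift_inject: "i \<le> n \<Longrightarrow> lift i \<alpha> = lift i \<beta> \<Longrightarrow> \<alpha> = \<beta>"
proof -
  assume i: "i \<le> n" and eq: "lift i \<alpha> = lift i \<beta>"
  have "label i = i" using i by (simp add: label_def)
  then have "(x, y) \<in> \<alpha> \<longleftrightarrow> (x, y) \<in> \<beta>" for x y
    using lift_iff[OF _ i, of i x y \<alpha>] lift_iff[OF _ i, of i x y \<beta>] eq by simp
  then show ?thesis by auto
qed

lemma lift_converse: "(lift i \<alpha>)\<inverse> = lift i (\<alpha>\<inverse>)"
  by (auto simp: lift_def)

lemma lift_relcomp_subset: "lift i (\<alpha> O \<beta>) \<subseteq> lift i \<alpha> O lift i \<beta>"
proof
  fix e assume "e \<in> lift i (\<alpha> O \<beta>)"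
  then obtain \<kappa> x y z where *: "e = (embed \<kappa> x, embed \<kappa> z)" "label \<kappa> = i" "(x, y) \<in> \<alpha>" "(y, z) \<in> \<beta>"
    unfolding lift_def by blast
  then have "(embed \<kappa> x, embed \<kappa> y) \<in> lift i \<alpha>" "(embed \<kappa> y, embed \<kappa> z) \<in> lift i \<beta>"
    unfolding lift_def by blast+
  then show "e \<in> lift i \<alpha> O lift i \<beta>" unfolding *(1) by (rule relcompI)
qed

lemma lift_relcomp:
  assumes "i \<le> n"
  shows "lift i \<alpha> O lift i \<beta> = lift i (\<alpha> O \<beta>)"
proof
  show "lift i \<alpha> O lift i \<beta> \<subseteq> lift i (\<alpha> O \<beta>)"
  proof clarify
    fix p q r assume "(p, q) \<in> lift i \<alpha>" "(q, r) \<in> lift i \<beta>"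
    then obtain \<kappa> x y \<mu> y' z where
      *: "p = embed \<kappa> x" "q = embed \<kappa> y" "label \<kappa> = i" "(x, y) \<in> \<alpha>"
        "q = embed \<mu> y'" "r = embed \<mu> z" "label \<mu> = i" "(y', z) \<in> \<beta>"
      unfolding lift_def by blast
    then have "\<kappa> = \<mu>" "y = y'"
      using embed_inject[of \<kappa> \<mu> y y'] assms by auto
    then show "(p, r) \<in> lift i (\<alpha> O \<beta>)"
      using * unfolding lift_def by blast
  qed
qed (rule lift_relcomp_subset)

lemma single_valued_lift: "i \<le> n \<Longrightarrow> single_valued \<alpha> \<Longrightarrow> single_valued (lift i \<alpha>)"
proof (rule single_valuedI)
  fix p q r assume i: "i \<le> n" and \<alpha>: "single_valued \<alpha>" and "(p, q) \<in> lift i \<alpha>" "(p, r) \<in> lift i \<alpha>"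
  then obtain \<kappa> x y \<mu> x' z where
    *: "p = embed \<kappa> x" "q = embed \<kappa> y" "label \<kappa> = i" "(x, y) \<in> \<alpha>"
      "p = embed \<mu> x'" "r = embed \<mu> z" "label \<mu> = i" "(x', z) \<in> \<alpha>"
    unfolding lift_def by blast
  then have "\<kappa> = \<mu>" "x = x'" using embed_inject[of \<kappa> \<mu> x x'] i by auto
  then show "q = r" using * \<alpha> by (auto dest: single_valuedD)
qed

section \<open>Closure of the tower under converse and composition\<close>

lemma thin_subset_tower: "thin \<subseteq> tower h"
  by (cases h) auto

lemma single_valued_tower: "\<alpha> \<in> tower h \<Longrightarrow> single_valued \<alpha>"
  by (induction h arbitrary: \<alpha>) (auto intro: thin_single_valued single_valued_lift)

lemma tower_converse: "\<alpha> \<in> tower h \<Longrightarrow> \<alpha>\<inverse> \<in> tower h"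
proof (induction h arbitrary: \<alpha>)
  case (Suc h)
  then show ?case by (auto simp: thin_converse lift_converse) blast
qed (simp add: thin_converse)

text \<open>Among the edges with labels up to \<open>n\<close>, only label 1 occurs at vertex
  \<open>0\<close> and only labels \<open>0\<close> and \<open>n\<close> occur at vertex
  \<open>2 * n\<close>, whereas a lift uses a single label. The closure under composition and the
  failure of idempotence both rest on this.\<close>

lemma tower_initial_final:
  assumes "\<alpha> \<in> tower h" "initial \<in> Domain \<alpha>"
  shows "final \<notin> Domain \<alpha>"
proof (cases "\<alpha> \<in> thin")
  case True
  then show ?thesis using assms(2) n3 by (auto simp: thin_def)
next
  case False
  then obtain i \<beta> where \<alpha>: "\<alpha> = lift i \<beta>" "i \<le> n" using assms(1) by (cases h) auto
  show ?thesis
  proof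
    assume "final \<in> Domain \<alpha>"
    then obtain \<kappa> x \<mu> y where *: "embed \<kappa> x = initial" "label \<kappa> = i" "embed \<mu> y = final" "label \<mu> = i"
      using assms(2) unfolding \<alpha>(1) lift_def by (auto 0 4)
    have "0 \<in> {src \<kappa>, tgt \<kappa>}" "2 * n \<in> {src \<mu>, tgt \<mu>}"
      using *(1,3) by (auto simp: embed_def split: if_splits)
    then show False
      using *(2,4) \<alpha>(2) n3 by (auto simp: label_def src_def tgt_def split: if_splits)
  qed
qed

lemma src_cases:
  "label \<kappa> \<le> n \<Longrightarrow> label \<kappa> = 0 \<and> src \<kappa> = n \<or> Suc (src \<kappa>) = label \<kappa> \<or>
    0 < label \<kappa> \<and> src \<kappa> = n + label \<kappa>"
  by (auto simp: label_def src_def)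

lemma tgt_cases:
  "label \<kappa> \<le> n \<Longrightarrow> label \<kappa> = 0 \<and> tgt \<kappa> = 2 * n \<or> 0 < label \<kappa> \<and> tgt \<kappa> = label \<kappa> \<or>
    0 < label \<kappa> \<and> Suc (tgt \<kappa>) = n + label \<kappa>"
  by (auto simp: label_def tgt_def)

text \<open>Consecutive labels \<open>i\<close> and \<open>i + 1\<close> meet at \<open>i\<close>,
  the target of edge \<open>i\<close>, and at \<open>n + i\<close>, the source of edge
  \<open>n + i\<close>, since the two occurrences of a letter are traversed in opposite order. The
  labels \<open>n\<close> and \<open>0\<close> meet likewise at \<open>n\<close> and
  \<open>2 * n\<close>. For \<open>n = 2\<close> the labels 1 and 2 would also meet at vertex 2 and
  break this, hence the bound \<open>3 \<le> n\<close>.\<close>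

lemma shared_vertices_opposite:
  assumes "label \<kappa> \<noteq> label \<mu>" "label \<kappa> \<le> n" "label \<mu> \<le> n"
    and \<kappa>': "label \<kappa>' = label \<kappa>" and \<mu>': "label \<mu>' = label \<mu>" and "a \<noteq> b"
    and a: "a \<in> {src \<kappa>, tgt \<kappa>}" "a \<in> {src \<mu>, tgt \<mu>}"
    and b: "b \<in> {src \<kappa>', tgt \<kappa>'}" "b \<in> {src \<mu>', tgt \<mu>'}"
  shows "a = src \<kappa> \<and> b = tgt \<kappa>' \<or> a = tgt \<kappa> \<and> b = src \<kappa>'"
proof -
  define i j where "i = label \<kappa>" and "j = label \<mu>"
  have ij: "i \<noteq> j" "i \<le> n" "j \<le> n" using assms by (simp_all add: i_def j_def)
  have A: "a = n \<and> j = 0 \<or> Suc a = j \<or> 0 < j \<and> a = n + j \<or>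
      a = 2 * n \<and> j = 0 \<or> 0 < j \<and> a = j \<or> 0 < j \<and> Suc a = n + j"
    using src_cases[of \<mu>] tgt_cases[of \<mu>] a(2) assms(3) unfolding j_def by auto
  have B: "b = n \<and> j = 0 \<or> Suc b = j \<or> 0 < j \<and> b = n + j \<or>
      b = 2 * n \<and> j = 0 \<or> 0 < j \<and> b = j \<or> 0 < j \<and> Suc b = n + j"
    using src_cases[of \<mu>'] tgt_cases[of \<mu>'] b(2) assms(3) \<mu>' unfolding j_def by auto
  have *: False
    if "Suc x = i \<and> y = n + i \<or> 0 < i \<and> x = i \<and> Suc y = n + i"
      "x = n \<and> j = 0 \<or> Suc x = j \<or> 0 < j \<and> x = n + j \<or>
      x = 2 * n \<and> j = 0 \<or> 0 < j \<and> x = j \<or> 0 < j \<and> Suc x = n + j"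
      "y = n \<and> j = 0 \<or> Suc y = j \<or> 0 < j \<and> y = n + j \<or>
      y = 2 * n \<and> j = 0 \<or> 0 < j \<and> y = j \<or> 0 < j \<and> Suc y = n + j"
    for x y
    using that(1)
  proof
    assume "Suc x = i \<and> y = n + i"
    with that(2,3) ij n3 show False by auto
  next
    assume "0 < i \<and> x = i \<and> Suc y = n + i"
    with that(2,3) ij n3 show False by auto
  qed
  have "\<not> (a = src \<kappa> \<and> b = src \<kappa>')"
  proof
    assume "a = src \<kappa> \<and> b = src \<kappa>'"
    then have "Suc a = i \<and> b = n + i \<or> Suc b = i \<and> a = n + i"
      using src_cases[of \<kappa>] src_cases[of \<kappa>'] \<kappa>' \<open>a \<noteq> b\<close> assms(2) unfolding i_def by auto
    then show False using *[of a b] *[of b a] A B by blast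
  qed
  moreover have "\<not> (a = tgt \<kappa> \<and> b = tgt \<kappa>')"
  proof
    assume "a = tgt \<kappa> \<and> b = tgt \<kappa>'"
    then have "0 < i \<and> (a = i \<and> Suc b = n + i \<or> b = i \<and> Suc a = n + i)"
      using tgt_cases[of \<kappa>] tgt_cases[of \<kappa>'] \<kappa>' \<open>a \<noteq> b\<close> assms(2) unfolding i_def by auto
    then show False using *[of a b] *[of b a] A B by blast
  qed
  ultimately show ?thesis using a(1) b(1) by blast
qed

text \<open>The middle point of a product of lifts with different labels is an outer vertex shared
  by both labels. Two such middle points would be opposite ends of copies with label
  \<open>i\<close>, so both \<open>initial\<close> and \<open>final\<close> would be in the range of
  \<open>\<alpha>\<close>, which the tower forbids. With one middle point, injectivity leaves at
  most one pair.\<close>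

lemma lift_relcomp_thin:
  assumes \<alpha>: "\<alpha> \<in> tower h" and \<beta>: "\<beta> \<in> tower h" and ij: "i \<noteq> j" "i \<le> n" "j \<le> n"
  shows "lift i \<alpha> O lift j \<beta> \<in> thin"
proof (rule thinI)
  have mid: "\<exists>a \<kappa> \<mu> v. q = Out a \<and> label \<kappa> = i \<and> label \<mu> = j \<and> a \<in> {src \<mu>, tgt \<mu>} \<and>
      v \<in> Range \<alpha> \<and> (v = initial \<and> a = src \<kappa> \<or> v = final \<and> a = tgt \<kappa>)"
    if pq: "(p, q) \<in> lift i \<alpha>" and qr: "(q, r) \<in> lift j \<beta>" for p q r
  proof -
    obtain \<kappa> x y \<mu> y' z where *: "q = embed \<kappa> y" "label \<kappa> = i" "(x, y) \<in> \<alpha>"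
      "q = embed \<mu> y'" "label \<mu> = j" "(y', z) \<in> \<beta>"
      using pq qr unfolding lift_def by blast
    have "q \<noteq> In \<mu> y'" if "q = In \<kappa> y" using that * ij(1) by auto
    then have y: "(y = initial \<and> q = Out (src \<kappa>) \<or> y = final \<and> q = Out (tgt \<kappa>)) \<and>
        (q = Out (src \<mu>) \<or> q = Out (tgt \<mu>))"
      using * by (auto simp: embed_def split: if_splits)
    then obtain a where "q = Out a" by blast
    then show ?thesis
      using y * by (intro exI[of _ a] exI[of _ \<kappa>] exI[of _ \<mu>] exI[of _ y]) auto
  qed
  have mid_unique: "q = q'"
    if q: "(p, q) \<in> lift i \<alpha>" "(q, r) \<in> lift j \<beta>"
      and q': "(p', q') \<in> lift i \<alpha>" "(q', r') \<in> lift j \<beta>"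
    for p q r p' q' r'
  proof (rule ccontr)
    assume "q \<noteq> q'"
    obtain a \<kappa> \<mu> v where 1: "q = Out a" "label \<kappa> = i" "label \<mu> = j" "a \<in> {src \<mu>, tgt \<mu>}"
      "v \<in> Range \<alpha>" "v = initial \<and> a = src \<kappa> \<or> v = final \<and> a = tgt \<kappa>"
      using mid[OF q] by blast
    obtain a' \<kappa>' \<mu>' v' where 2: "q' = Out a'" "label \<kappa>' = i" "label \<mu>' = j" "a' \<in> {src \<mu>', tgt \<mu>'}"
      "v' \<in> Range \<alpha>" "v' = initial \<and> a' = src \<kappa>' \<or> v' = final \<and> a' = tgt \<kappa>'"
      using mid[OF q'] by blast
    have "a = src \<kappa> \<and> a' = tgt \<kappa>' \<or> a = tgt \<kappa> \<and> a' = src \<kappa>'"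
    proof (rule shared_vertices_opposite[of \<kappa> \<mu> \<kappa>' \<mu>' a a'])
      show "a \<noteq> a'" using 1(1) 2(1) \<open>q \<noteq> q'\<close> by simp
      show "a \<in> {src \<kappa>, tgt \<kappa>}" "a' \<in> {src \<kappa>', tgt \<kappa>'}" using 1(6) 2(6) by auto
    qed (use 1(2-4) 2(2-4) ij in simp_all)
    then have "v \<noteq> v'"
      using 1(6) 2(6) src_neq_tgt[of \<kappa>] src_neq_tgt[of \<kappa>'] initial_neq_final by metis
    then have "initial \<in> Range \<alpha>" "final \<in> Range \<alpha>" using 1(5,6) 2(5,6) by auto
    then show False
      using tower_initial_final[OF tower_converse[OF \<alpha>]] by simp
  qed
  fix e e' assume "e \<in> lift i \<alpha> O lift j \<beta>" "e' \<in> lift i \<alpha> O lift j \<beta>"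
  then obtain p q r p' q' r' where *: "e = (p, r)" "(p, q) \<in> lift i \<alpha>" "(q, r) \<in> lift j \<beta>"
    "e' = (p', r')" "(p', q') \<in> lift i \<alpha>" "(q', r') \<in> lift j \<beta>"
    by blast
  have "q = q'" using mid_unique[OF *(2,3,5,6)] .
  moreover have "single_valued (lift i (\<alpha>\<inverse>))" "single_valued (lift j \<beta>)"
    by (intro single_valued_lift single_valued_tower[OF tower_converse[OF \<alpha>]] single_valued_tower[OF \<beta>] ij)+
  ultimately show "e = e'"
    using * single_valuedD[of "lift i (\<alpha>\<inverse>)" q p p'] single_valuedD[of "lift j \<beta>" q r r']
    unfolding lift_converse[symmetric] by simp
qed

lemma thin_relcomp:
  assumes "\<alpha> \<in> thin" "single_valued \<beta>"
  shows "\<alpha> O \<beta> \<in> thin"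
proof (rule thinI)
  fix p p' assume "p \<in> \<alpha> O \<beta>" "p' \<in> \<alpha> O \<beta>"
  then obtain x y z x' y' z' where *: "p = (x, z)" "(x, y) \<in> \<alpha>" "(y, z) \<in> \<beta>"
    "p' = (x', z')" "(x', y') \<in> \<alpha>" "(y', z') \<in> \<beta>"
    by blast
  moreover have "(x, y) = (x', y')" using thinD[OF assms(1) *(2) *(5)] .
  ultimately show "p = p'" using assms(2) by (auto dest: single_valuedD)
qed

lemma tower_relcomp:
  assumes "\<alpha> \<in> tower h" "\<beta> \<in> tower h"
  shows "\<alpha> O \<beta> \<in> tower h"
  using assms
proof (induction h arbitrary: \<alpha> \<beta>)
  case 0
  then show ?case using thin_relcomp[of \<alpha> \<beta>] thin_single_valued[of \<beta>] by simp
next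
  case (Suc h)
  show ?case
  proof (cases "\<alpha> \<in> thin \<or> \<beta> \<in> thin")
    case True
    then have "\<alpha> O \<beta> \<in> thin"
    proof
      assume "\<beta> \<in> thin"
      then have "\<beta>\<inverse> O \<alpha>\<inverse> \<in> thin"
        using thin_relcomp[of "\<beta>\<inverse>" "\<alpha>\<inverse>"] single_valued_tower[OF tower_converse[OF Suc.prems(1)]]
        by (simp add: thin_converse)
      then show ?thesis unfolding converse_relcomp[symmetric] by (simp only: thin_converse)
    next
      assume "\<alpha> \<in> thin"
      then show ?thesis using thin_relcomp single_valued_tower[OF Suc.prems(2)] by blast
    qed
    then show ?thesis using thin_subset_tower by blast
  next
    case False
    then obtain i \<alpha>' j \<beta>' where *: "\<alpha> = lift i \<alpha>'" "i \<le> n" "\<alpha>' \<in> tower h"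
      "\<beta> = lift j \<beta>'" "j \<le> n" "\<beta>' \<in> tower h"
      using Suc.prems by auto
    show ?thesis
    proof (cases "i = j")
      case True
      then show ?thesis using * lift_relcomp[of i \<alpha>' \<beta>'] Suc.IH[of \<alpha>' \<beta>'] by auto
    next
      case False
      then show ?thesis using * lift_relcomp_thin by simp
    qed
  qed
qed

lemma algebra21_tower: "algebra21 (rel_algebra (tower h))"
proof -
  have "{} \<in> tower h" using thin_subset_tower thin_empty by blast
  then show ?thesis by (auto simp: algebra21_def tower_relcomp tower_converse)
qed

section \<open>Cuts of small subsets of the tower\<close>

text \<open>The first and the third condition give the identities (ranges are handled through
  converses). The other two carry the induction: the second isolates a point inside a copy while the
  outer vertices stay monochromatic, and the fourth is used for an outer vertex off the copies,
  which needs a colour that the image of the relation misses.\<close>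

definition good :: "vertex rel set \<Rightarrow> bool" where
  "good E \<longleftrightarrow>
    (\<forall>p q. p \<noteq> q \<longrightarrow> (\<exists>f. cut E f \<and> f p \<noteq> f q)) \<and>
    (\<forall>p. p \<noteq> initial \<and> p \<noteq> final \<longrightarrow> (\<exists>f. cut E f \<and> f initial = f final \<and> f p \<noteq> f initial)) \<and>
    (\<forall>\<alpha>\<in>E. \<forall>p. p \<notin> Domain \<alpha> \<longrightarrow> (\<exists>f. cut E f \<and> f p \<notin> Domain (rel_image f \<alpha>))) \<and>
    (\<forall>\<alpha>\<in>E. \<exists>f. cut E f \<and> f initial \<noteq> f final \<and> rel_image f \<alpha> \<noteq> Id)"

lemma
  assumes "good E"
  shows good_separated: "p \<noteq> q \<Longrightarrow> \<exists>f. cut E f \<and> f p \<noteq> f q"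
    and good_inner: "p \<noteq> initial \<Longrightarrow> p \<noteq> final \<Longrightarrow>
      \<exists>f. cut E f \<and> f initial = f final \<and> f p \<noteq> f initial"
    and good_Domain: "\<alpha> \<in> E \<Longrightarrow> p \<notin> Domain \<alpha> \<Longrightarrow>
      \<exists>f. cut E f \<and> f p \<notin> Domain (rel_image f \<alpha>)"
    and good_crossing: "\<alpha> \<in> E \<Longrightarrow> \<exists>f. cut E f \<and> f initial \<noteq> f final \<and> rel_image f \<alpha> \<noteq> Id"
  using assms by (simp_all add: good_def)

lemma cut_Not: "cut E f \<Longrightarrow> cut E (\<lambda>v. \<not> f v)"
proof -
  have "rel_image (\<lambda>v. \<not> f v) \<alpha> = rel_image Not (rel_image f \<alpha>)" for \<alpha>
    unfolding rel_image_def image_image by (rule image_cong) auto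
  moreover have "rel_image Not \<beta> \<in> B21_rel" if "\<beta> \<in> B21_rel" for \<beta>
  proof (cases "\<beta> = Id")
    case True
    have "rel_image Not Id \<subseteq> Id" by (auto simp: rel_image_def)
    moreover have "(b, b) \<in> rel_image Not Id" for b
      using rel_imageI[of "\<not> b" "\<not> b" Id Not] by simp
    ultimately have "rel_image Not Id = Id" by auto
    then show ?thesis using True by (simp add: B21_rel_def)
  next
    case False
    then have "\<beta> \<in> thin" using that by (simp add: B21_rel_def)
    then show ?thesis by (rule rel_image_thin_B21)
  qed
  ultimately show "cut E f \<Longrightarrow> cut E (\<lambda>v. \<not> f v)" by (simp add: cut_def)
qed

lemma cut_thin: "E \<subseteq> thin \<Longrightarrow> cut E f"
  unfolding cut_def using rel_image_thin_B21 by blast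

lemma subset_single_thin: "\<alpha> \<subseteq> {(a, b)} \<Longrightarrow> \<alpha> \<in> thin"
  by (auto simp: thin_def)

lemma good_thin:
  assumes "E \<subseteq> thin"
  shows "good E"
  unfolding good_def
proof (intro conjI allI ballI impI)
  note cut = cut_thin[OF assms]
  show "\<exists>f. cut E f \<and> f p \<noteq> f q" if "p \<noteq> q" for p q
    using that cut by (intro exI[of _ "\<lambda>x. x = p"]) auto
  show "\<exists>f. cut E f \<and> f initial = f final \<and> f p \<noteq> f initial" if "p \<noteq> initial \<and> p \<noteq> final" for p
    using that cut by (intro exI[of _ "\<lambda>x. x = p"]) auto
  show "\<exists>f. cut E f \<and> f p \<notin> Domain (rel_image f \<alpha>)" if "\<alpha> \<in> E" "p \<notin> Domain \<alpha>" for \<alpha> p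
    using that cut by (intro exI[of _ "\<lambda>x. x = p"]) (auto simp: Domain_rel_image)
  show "\<exists>f. cut E f \<and> f initial \<noteq> f final \<and> rel_image f \<alpha> \<noteq> Id" if "\<alpha> \<in> E" for \<alpha>
  proof (intro exI[of _ "\<lambda>x. x = initial"] conjI cut)
    have "rel_image (\<lambda>x. x = initial) \<alpha> \<in> thin" using that assms rel_image_thin by blast
    then show "rel_image (\<lambda>x. x = initial) \<alpha> \<noteq> Id" using Id_bool_not_thin by metis
  qed (use n3 in simp)
qed

end

text \<open>One step of the induction: \<open>Sub i\<close> is the part of \<open>E\<close> that acts inside the copies with
  label \<open>i\<close>. No element of \<open>E\<close> acts inside the copies with label \<open>j\<close>.\<close>

locale level = iterated_graph +
  fixes E :: "vertex rel set" and Sub :: "nat \<Rightarrow> vertex rel set" and j :: nat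
  assumes j: "1 \<le> j" "j \<le> n"
    and E_cases: "\<And>\<alpha>. \<alpha> \<in> E \<Longrightarrow> \<alpha> \<in> thin \<or> (\<exists>i \<beta>. i \<le> n \<and> i \<noteq> j \<and> \<beta> \<in> Sub i \<and> \<alpha> = lift i \<beta>)"
    and good_Sub: "\<And>i. i \<le> n \<Longrightarrow> good (Sub i)"
begin

section \<open>Gluing cuts of the copies along a colouring of the outer path\<close>

primrec glue :: "(nat \<Rightarrow> bool) \<Rightarrow> (nat \<Rightarrow> vertex \<Rightarrow> bool) \<Rightarrow> vertex \<Rightarrow> bool" where
  "glue F \<gamma> (Out m) = F m"
| "glue F \<gamma> (In \<kappa> v) = \<gamma> \<kappa> v"

lemma glue_embed:
  "\<gamma> \<kappa> initial = F (src \<kappa>) \<Longrightarrow> \<gamma> \<kappa> final = F (tgt \<kappa>) \<Longrightarrow> glue F \<gamma> (embed \<kappa> v) = \<gamma> \<kappa> v"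
  by (auto simp: embed_def)

lemma rel_image_lift_eq:
  assumes "i \<le> n" "\<And>\<kappa> v. label \<kappa> = i \<Longrightarrow> f (embed \<kappa> v) = g v"
  shows "rel_image f (lift i \<beta>) = rel_image g \<beta>"
proof
  show "rel_image f (lift i \<beta>) \<subseteq> rel_image g \<beta>"
  proof
    fix e assume "e \<in> rel_image f (lift i \<beta>)"
    then obtain \<kappa> x y where *: "e = (f (embed \<kappa> x), f (embed \<kappa> y))" "label \<kappa> = i" "(x, y) \<in> \<beta>"
      unfolding rel_image_def lift_def by auto
    then show "e \<in> rel_image g \<beta>" using rel_imageI[OF *(3), of g] assms(2)[OF *(2)] by simp
  qed
  have i: "label i = i" using assms(1) by (simp add: label_def)
  show "rel_image g \<beta> \<subseteq> rel_image f (lift i \<beta>)"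
  proof
    fix e assume "e \<in> rel_image g \<beta>"
    then obtain x y where *: "(x, y) \<in> \<beta>" "e = (g x, g y)" by (auto simp: rel_image_def)
    then have "(embed i x, embed i y) \<in> lift i \<beta>" using i unfolding lift_def by blast
    then have "(f (embed i x), f (embed i y)) \<in> rel_image f (lift i \<beta>)" by (rule rel_imageI)
    then show "e \<in> rel_image f (lift i \<beta>)" using * assms(2)[OF i] by simp
  qed
qed

text \<open>The constant may vary from copy to copy, and then the image can be all of
  \<open>Id\<close>. This is where the unit matrix in B_2^1 enters.\<close>

lemma rel_image_lift_Id:
  assumes "\<And>\<kappa> v w. label \<kappa> = i \<Longrightarrow> f (embed \<kappa> v) = f (embed \<kappa> w)"
  shows "rel_image f (lift i \<beta>) \<subseteq> Id"
proof
  fix e assume "e \<in> rel_image f (lift i \<beta>)"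
  then obtain \<kappa> x y where "e = (f (embed \<kappa> x), f (embed \<kappa> y))" "label \<kappa> = i"
    unfolding rel_image_def lift_def by auto
  then show "e \<in> Id" using assms[of \<kappa> x y] by simp
qed

lemma B21_relI:
  assumes "\<alpha> \<subseteq> Id"
  shows "\<alpha> \<in> B21_rel"
proof -
  have *: "\<alpha> \<subseteq> {(b, b)}" if "(\<not> b, \<not> b) \<notin> \<alpha>" for b
  proof
    fix e assume e: "e \<in> \<alpha>"
    from subsetD[OF assms e] obtain c where "e = (c, c)" by (rule IdE)
    then show "e \<in> {(b, b)}" using e that by (cases c; cases b) simp_all
  qed
  show ?thesis
  proof (cases "\<exists>b. (\<not> b, \<not> b) \<notin> \<alpha>")
    case True
    then obtain b where "(\<not> b, \<not> b) \<notin> \<alpha>" by (rule exE)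
    from subset_single_thin[OF *[OF this]] have "\<alpha> \<in> thin" .
    then show ?thesis by (simp add: B21_rel_def)
  next
    case False
    then have "(b, b) \<in> \<alpha>" for b by (cases b) (simp_all add: ex_bool_eq)
    then have "Id \<subseteq> \<alpha>" by (intro subsetI) (erule IdE, simp)
    with assms have "\<alpha> = Id" by (rule subset_antisym)
    then show ?thesis by (simp add: B21_rel_def)
  qed
qed

text \<open>If all copies with label \<open>i\<close> carry the same \<open>g\<close>, then the
  image of \<open>lift i \<beta>\<close> is that of \<open>\<beta>\<close> under \<open>g\<close>;
  if each copy is monochromatic, the image lies in \<open>Id\<close>. The copies labelled
  \<open>j\<close> only have to match at their ends.\<close>

lemma cut_glue:
  assumes "\<And>\<kappa>. \<gamma> \<kappa> initial = F (src \<kappa>)" "\<And>\<kappa>. \<gamma> \<kappa> final = F (tgt \<kappa>)"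
    and "\<And>i. i \<le> n \<Longrightarrow> i \<noteq> j \<Longrightarrow>
      (\<exists>g. cut (Sub i) g \<and> (\<forall>\<kappa>. label \<kappa> = i \<longrightarrow> \<gamma> \<kappa> = g)) \<or>
      (\<forall>\<kappa>. label \<kappa> = i \<longrightarrow> (\<forall>v w. \<gamma> \<kappa> v = \<gamma> \<kappa> w))"
  shows "cut E (glue F \<gamma>)"
  unfolding cut_def
proof
  fix \<alpha> assume "\<alpha> \<in> E"
  then consider "\<alpha> \<in> thin" | i \<beta> where "i \<le> n" "i \<noteq> j" "\<beta> \<in> Sub i" "\<alpha> = lift i \<beta>"
    using E_cases by blast
  then show "rel_image (glue F \<gamma>) \<alpha> \<in> B21_rel"
  proof cases
    case 1
    then show ?thesis by (rule rel_image_thin_B21)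
  next
    case (2 i \<beta>)
    have emb: "glue F \<gamma> (embed \<kappa> v) = \<gamma> \<kappa> v" for \<kappa> v
      using glue_embed assms(1,2) by simp
    from assms(3)[OF 2(1,2)] show ?thesis
    proof
      assume "\<exists>g. cut (Sub i) g \<and> (\<forall>\<kappa>. label \<kappa> = i \<longrightarrow> \<gamma> \<kappa> = g)"
      then obtain g where g: "cut (Sub i) g" "\<And>\<kappa>. label \<kappa> = i \<Longrightarrow> \<gamma> \<kappa> = g" by blast
      have "rel_image (glue F \<gamma>) \<alpha> = rel_image g \<beta>"
        unfolding 2(4) using 2(1) by (rule rel_image_lift_eq) (simp add: emb g(2))
      then show ?thesis using g(1) 2(3) by (simp add: cut_def)
    next
      assume "\<forall>\<kappa>. label \<kappa> = i \<longrightarrow> (\<forall>v w. \<gamma> \<kappa> v = \<gamma> \<kappa> w)"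
      then have "rel_image (glue F \<gamma>) \<alpha> \<subseteq> Id"
        unfolding 2(4) by (intro rel_image_lift_Id) (simp add: emb)
      then show ?thesis by (rule B21_relI)
    qed
  qed
qed

text \<open>The alternatives say that the edges \<open>i\<close> and \<open>n + i\<close> are both
  contracted, or that their sources agree in colour and their targets agree in colour. Label 0 has a
  single edge and imposes nothing.\<close>

definition admissible :: "(nat \<Rightarrow> bool) \<Rightarrow> bool" where
  "admissible F \<longleftrightarrow> (\<forall>i. 1 \<le> i \<and> i \<le> n \<and> i \<noteq> j \<longrightarrow>
    F (i - 1) = F i \<and> F (n + i) = F (n + i - 1) \<or> F (i - 1) = F (n + i) \<and> F i = F (n + i - 1))"

definition contracts :: "(nat \<Rightarrow> bool) \<Rightarrow> nat \<Rightarrow> bool" where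
  "contracts F i \<longleftrightarrow> (\<forall>\<kappa>. label \<kappa> = i \<longrightarrow> F (src \<kappa>) = F (tgt \<kappa>))"

lemma edges_of_label:
  assumes "1 \<le> i" "i \<le> n"
  shows "label \<kappa> = i \<Longrightarrow> (src \<kappa> = i - 1 \<and> tgt \<kappa> = i) \<or> (src \<kappa> = n + i \<and> tgt \<kappa> = n + i - 1)"
  using assms by (auto simp: label_def src_def tgt_def split: if_splits)

lemma admissible_parallel:
  assumes "admissible F" "i \<le> n" "i \<noteq> j" "\<not> contracts F i"
  shows "\<exists>a. \<forall>\<kappa>. label \<kappa> = i \<longrightarrow> F (src \<kappa>) = a \<and> F (tgt \<kappa>) = (\<not> a)"
proof (cases "i = 0")
  case True
  then show ?thesis using assms(4) unfolding contracts_def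
    by (intro exI[of _ "F n"]) (auto simp: label_def src_def tgt_def split: if_splits)
next
  case False
  then have i: "1 \<le> i" by simp
  have "F (i - 1) = F i \<and> F (n + i) = F (n + i - 1) \<or> F (i - 1) = F (n + i) \<and> F i = F (n + i - 1)"
    using assms(1-3) i unfolding admissible_def by blast
  then show ?thesis
    using assms(4) edges_of_label[OF i assms(2)] unfolding contracts_def by metis
qed

lemma separating_cut:
  assumes "i \<le> n" "v \<noteq> w"
  obtains g where "cut (Sub i) g" "g v = a" "g w = (\<not> a)"
proof -
  obtain g where g: "cut (Sub i) g" "g v \<noteq> g w"
    using good_separated[OF good_Sub[OF assms(1)] assms(2)] by blast
  show thesis
  proof (cases "g v = a")
    case True
    moreover have "g w = (\<not> a)" using g(2) True by simp
    ultimately show ?thesis by (rule that[OF g(1)])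
  next
    case False
    show ?thesis
      by (rule that[OF cut_Not[OF g(1)]]) (use False g(2) in simp_all)
  qed
qed

text \<open>A label outside \<open>I\<close> that is not contracted gets a cut of its own that
  separates \<open>initial\<close> from \<open>final\<close>; by \<open>admissible_parallel\<close>
  one cut fits all its copies. The set \<open>I\<close> allows a chosen \<open>g\<close> to be
  placed in all copies with one label.\<close>

lemma extend:
  assumes F: "admissible F"
    and I: "\<And>\<kappa>. label \<kappa> \<in> I \<Longrightarrow>
      label \<kappa> \<le> n \<and> label \<kappa> \<noteq> j \<and> cut (Sub (label \<kappa>)) g \<and> g initial = F (src \<kappa>) \<and> g final = F (tgt \<kappa>)"
  shows "\<exists>f. cut E f \<and> (\<forall>m. f (Out m) = F m) \<and>
    (\<forall>\<kappa> v. label \<kappa> \<in> I \<longrightarrow> f (embed \<kappa> v) = g v \<and> f (In \<kappa> v) = g v) \<and>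
    (\<forall>\<kappa> v. label \<kappa> \<notin> I \<and> contracts F (label \<kappa>) \<longrightarrow>
      f (embed \<kappa> v) = F (src \<kappa>) \<and> f (In \<kappa> v) = F (src \<kappa>))"
proof -
  have "\<forall>i. \<exists>c. i \<le> n \<and> i \<noteq> j \<and> \<not> contracts F i \<longrightarrow>
      cut (Sub i) c \<and> (\<forall>\<kappa>. label \<kappa> = i \<longrightarrow> c initial = F (src \<kappa>) \<and> c final = F (tgt \<kappa>))"
  proof
    fix i
    show "\<exists>c. i \<le> n \<and> i \<noteq> j \<and> \<not> contracts F i \<longrightarrow>
      cut (Sub i) c \<and> (\<forall>\<kappa>. label \<kappa> = i \<longrightarrow> c initial = F (src \<kappa>) \<and> c final = F (tgt \<kappa>))"
    proof (cases "i \<le> n \<and> i \<noteq> j \<and> \<not> contracts F i")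
      case True
      then have "i \<le> n" "i \<noteq> j" "\<not> contracts F i" by simp_all
      from admissible_parallel[OF F this] obtain a
        where a: "\<forall>\<kappa>. label \<kappa> = i \<longrightarrow> F (src \<kappa>) = a \<and> F (tgt \<kappa>) = (\<not> a)"
        by (rule exE)
      obtain c where "cut (Sub i) c" "c initial = a" "c final = (\<not> a)"
        by (rule separating_cut[OF \<open>i \<le> n\<close> initial_neq_final])
      then show ?thesis using a by (intro exI[of _ c]) simp
    next
      case False
      then show ?thesis by blast
    qed
  qed
  from choice[OF this] obtain c where c: "\<forall>i. i \<le> n \<and> i \<noteq> j \<and> \<not> contracts F i \<longrightarrow>
      cut (Sub i) (c i) \<and> (\<forall>\<kappa>. label \<kappa> = i \<longrightarrow> c i initial = F (src \<kappa>) \<and> c i final = F (tgt \<kappa>))"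
    by (rule exE)
  \<comment> \<open>The last branch is reached only for label \<open>j\<close> and for labels above
    \<open>n\<close>; there any function with the right values at the two ends is compatible with
    \<open>E\<close>.\<close>
  define \<gamma> where "\<gamma> \<kappa> = (if label \<kappa> \<in> I then g else if contracts F (label \<kappa>) then (\<lambda>_. F (src \<kappa>))
    else if label \<kappa> \<le> n \<and> label \<kappa> \<noteq> j then c (label \<kappa>)
    else (\<lambda>v. if v = initial then F (src \<kappa>) else F (tgt \<kappa>)))" for \<kappa>
  have \<gamma>_I: "\<gamma> \<kappa> = g" if "label \<kappa> \<in> I" for \<kappa>
    using that by (simp add: \<gamma>_def)
  have \<gamma>_contracts: "\<gamma> \<kappa> = (\<lambda>_. F (src \<kappa>))" if "label \<kappa> \<notin> I" "contracts F (label \<kappa>)" for \<kappa>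
    using that by (simp add: \<gamma>_def)
  have \<gamma>: "\<gamma> \<kappa> initial = F (src \<kappa>)" "\<gamma> \<kappa> final = F (tgt \<kappa>)" for \<kappa>
  proof -
    have "\<gamma> \<kappa> initial = F (src \<kappa>) \<and> \<gamma> \<kappa> final = F (tgt \<kappa>)"
    proof (cases "label \<kappa> \<in> I")
      case True
      then show ?thesis using I[OF True] by (simp add: \<gamma>_def)
    next
      case nI: False
      show ?thesis
      proof (cases "contracts F (label \<kappa>)")
        case True
        then have "F (src \<kappa>) = F (tgt \<kappa>)" by (simp add: contracts_def)
        then show ?thesis using nI True by (simp add: \<gamma>_def)
      next
        case False
        then show ?thesis
          using nI c[rule_format, of "label \<kappa>"] initial_neq_final by (simp add: \<gamma>_def)
      qed
    qed
    then show "\<gamma> \<kappa> initial = F (src \<kappa>)" "\<gamma> \<kappa> final = F (tgt \<kappa>)" by simp_all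
  qed
  have "cut E (glue F \<gamma>)"
  proof (rule cut_glue)
    fix i assume i: "i \<le> n" "i \<noteq> j"
    have ii: "label i = i" using i by (simp add: label_def)
    show "(\<exists>g. cut (Sub i) g \<and> (\<forall>\<kappa>. label \<kappa> = i \<longrightarrow> \<gamma> \<kappa> = g)) \<or>
      (\<forall>\<kappa>. label \<kappa> = i \<longrightarrow> (\<forall>v w. \<gamma> \<kappa> v = \<gamma> \<kappa> w))"
    proof (cases "i \<in> I")
      case True
      then have "cut (Sub i) g" using I[of i] ii by simp
      then show ?thesis using True \<gamma>_I by (intro disjI1 exI[of _ g]) simp
    next
      case False
      then show ?thesis
      proof (cases "contracts F i")
        case True
        then show ?thesis using False \<gamma>_contracts by (intro disjI2) simp
      next
        case nc: False
        then show ?thesis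
          using False i c[rule_format, of i] by (intro disjI1 exI[of _ "c i"]) (simp add: \<gamma>_def)
      qed
    qed
  qed (rule \<gamma>)+
  moreover have "glue F \<gamma> (embed \<kappa> v) = \<gamma> \<kappa> v" for \<kappa> v
    by (rule glue_embed[OF \<gamma>])
  ultimately show ?thesis
    by (intro exI[of _ "glue F \<gamma>"] conjI allI impI) (simp_all add: \<gamma>_I \<gamma>_contracts)
qed

lemma extend_contracting:
  assumes "admissible F"
  shows "\<exists>f. cut E f \<and> (\<forall>m. f (Out m) = F m) \<and>
    (\<forall>\<kappa> v. contracts F (label \<kappa>) \<longrightarrow> f (embed \<kappa> v) = F (src \<kappa>) \<and> f (In \<kappa> v) = F (src \<kappa>))"
proof -
  have "\<exists>f. cut E f \<and> (\<forall>m. f (Out m) = F m) \<and>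
    (\<forall>\<kappa> v. label \<kappa> \<in> {} \<longrightarrow> f (embed \<kappa> v) = False \<and> f (In \<kappa> v) = False) \<and>
    (\<forall>\<kappa> v. label \<kappa> \<notin> {} \<and> contracts F (label \<kappa>) \<longrightarrow>
      f (embed \<kappa> v) = F (src \<kappa>) \<and> f (In \<kappa> v) = F (src \<kappa>))"
    by (rule extend[OF assms]) (simp only: empty_iff)
  then show ?thesis by blast
qed

text \<open>The complementary colouring with values \<open>H\<close> on \<open>0, \<dots>, n\<close>; it is consistent at \<open>n\<close>, the
  partner of \<open>0\<close>, only if \<open>H n\<close> and \<open>H 0\<close> differ.\<close>

definition compl :: "(nat \<Rightarrow> bool) \<Rightarrow> nat \<Rightarrow> bool" where
  "compl H m = (if m \<le> n then H m else \<not> H (m - n))"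

lemma compl_le: "k \<le> n \<Longrightarrow> compl H k = H k"
  by (simp add: compl_def)

lemma compl_add: "H n = (\<not> H 0) \<Longrightarrow> compl H (n + k) = (\<not> H k)"
  by (cases "k = 0") (simp_all add: compl_def)

text \<open>Complementing turns a colour change from \<open>i - 1\<close> to \<open>i\<close> into
  the opposite change from \<open>n + i - 1\<close> to \<open>n + i\<close>. Edge
  \<open>n + i\<close> runs backwards, so both edges are crossed in the same direction, for every
  label at once.\<close>

lemma admissible_compl:
  assumes "H n = (\<not> H 0)"
  shows "admissible (compl H)"
  unfolding admissible_def
proof (intro allI impI)
  fix i assume i: "1 \<le> i \<and> i \<le> n \<and> i \<noteq> j"
  have "compl H (n + i - 1) = (\<not> H (i - 1))"
    using compl_add[OF assms, of "i - 1"] i by simp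
  moreover have "compl H (n + i) = (\<not> H i)" by (rule compl_add[OF assms])
  moreover have "compl H (i - 1) = H (i - 1)" "compl H i = H i"
    by (rule compl_le, use i in linarith)+
  ultimately show "compl H (i - 1) = compl H i \<and> compl H (n + i) = compl H (n + i - 1) \<or>
      compl H (i - 1) = compl H (n + i) \<and> compl H i = compl H (n + i - 1)"
    by (cases "H i"; cases "H (i - 1)") simp_all
qed

lemma compl_edge:
  assumes "H n = (\<not> H 0)" "1 \<le> i" "i \<le> n" "label \<kappa> = i"
  shows "\<kappa> = i \<and> compl H (src \<kappa>) = H (i - 1) \<and> compl H (tgt \<kappa>) = H i \<or>
    \<kappa> = n + i \<and> compl H (src \<kappa>) = (\<not> H i) \<and> compl H (tgt \<kappa>) = (\<not> H (i - 1))"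
proof -
  have "\<kappa> = i \<or> \<kappa> = n + i" using assms(2-4) by (auto simp: label_def split: if_splits)
  then show ?thesis
  proof
    assume "\<kappa> = i"
    then have "src \<kappa> = i - 1" "tgt \<kappa> = i" using assms(2,3) by (simp_all add: src_def tgt_def)
    moreover have "compl H (i - 1) = H (i - 1)" "compl H i = H i"
      by (rule compl_le, use assms(3) in linarith)+
    ultimately show ?thesis using \<open>\<kappa> = i\<close> by simp
  next
    assume \<kappa>: "\<kappa> = n + i"
    then have "src \<kappa> = n + i" "tgt \<kappa> = n + (i - 1)" using assms(2) by (simp_all add: src_def tgt_def)
    then show ?thesis using compl_add[OF assms(1)] \<kappa> by simp
  qed
qed

text \<open>The colour changes along edge \<open>j\<close> but not along edge \<open>n + j\<close>,
  so compatibility fails at label \<open>j\<close> only. \<open>admissible_right\<close> is the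
  mirror image, with the change along \<open>n + j\<close>.\<close>

lemma admissible_left: "admissible (\<lambda>m. m < j)"
  unfolding admissible_def
proof (intro allI impI disjI1)
  fix i assume i: "1 \<le> i \<and> i \<le> n \<and> i \<noteq> j"
  show "(i - 1 < j) = (i < j) \<and> (n + i < j) = (n + i - 1 < j)"
    using i j by (cases "i < j") auto
qed

lemma admissible_right: "admissible (\<lambda>m. n + j \<le> m)"
  unfolding admissible_def
proof (intro allI impI disjI1)
  fix i assume i: "1 \<le> i \<and> i \<le> n \<and> i \<noteq> j"
  show "(n + j \<le> i - 1) = (n + j \<le> i) \<and> (n + j \<le> n + i) = (n + j \<le> n + i - 1)"
    using i j by (cases "i < j") auto
qed

lemma admissible_const: "admissible (\<lambda>_. b)"
  by (simp add: admissible_def)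

text \<open>The indicator of a point outside all copies with labels other than \<open>j\<close> is
  constant on each of these copies, so all lifts in \<open>E\<close> are mapped into
  \<open>Id\<close>.\<close>

lemma private_cut:
  assumes "\<And>\<kappa> v. label \<kappa> \<le> n \<Longrightarrow> label \<kappa> \<noteq> j \<Longrightarrow> embed \<kappa> v \<noteq> p"
  shows "cut E (\<lambda>x. x = p)"
  unfolding cut_def
proof
  fix \<alpha> assume "\<alpha> \<in> E"
  then consider "\<alpha> \<in> thin" | i \<beta> where "i \<le> n" "i \<noteq> j" "\<beta> \<in> Sub i" "\<alpha> = lift i \<beta>"
    using E_cases by blast
  then show "rel_image (\<lambda>x. x = p) \<alpha> \<in> B21_rel"
  proof cases
    case 1
    then show ?thesis by (rule rel_image_thin_B21)
  next
    case (2 i \<beta>)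
    then have "rel_image (\<lambda>x. x = p) \<alpha> \<subseteq> Id"
      unfolding 2(4) using assms by (intro rel_image_lift_Id) auto
    then show ?thesis by (rule B21_relI)
  qed
qed

lemma private_inner_cut:
  assumes "\<not> (label \<kappa> \<le> n \<and> label \<kappa> \<noteq> j \<and> v \<noteq> initial \<and> v \<noteq> final)"
  shows "cut E (\<lambda>x. x = In \<kappa> v)"
  by (rule private_cut) (use assms in \<open>auto simp: embed_def split: if_splits\<close>)

lemma private_outer_cut:
  assumes "2 * n < m"
  shows "cut E (\<lambda>x. x = Out m)"
proof (rule private_cut)
  fix \<kappa> v assume "label \<kappa> \<le> n"
  then have "src \<kappa> \<le> 2 * n" "tgt \<kappa> \<le> 2 * n"
    by (auto simp: label_def src_def tgt_def split: if_splits)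
  then show "embed \<kappa> v \<noteq> Out m" using assms by (auto simp: embed_def)
qed

text \<open>With all outer vertices of one colour, the second condition of \<open>good\<close> is
  placed in every copy with the label of \<open>\<kappa>\<close>. Two copies with the same label may
  thus be coloured alike; \<open>copies_cut\<close> tells them apart.\<close>

lemma inner_cut:
  obtains f where "cut E f" "f (In \<kappa> v)" "\<And>m. \<not> f (Out m)"
    "\<And>\<mu> w. label \<mu> \<noteq> label \<kappa> \<Longrightarrow> \<not> f (In \<mu> w)"
proof (cases "label \<kappa> \<le> n \<and> label \<kappa> \<noteq> j \<and> v \<noteq> initial \<and> v \<noteq> final")
  case True
  then obtain g where g: "cut (Sub (label \<kappa>)) g" "g initial = g final" "g v \<noteq> g initial"
    using good_inner[OF good_Sub, of "label \<kappa>" v] by blast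
  obtain h where h: "cut (Sub (label \<kappa>)) h" "\<not> h initial" "\<not> h final" "h v"
  proof (cases "g initial")
    case True
    show ?thesis by (rule that[OF cut_Not[OF g(1)]]) (use True g(2,3) in simp_all)
  next
    case False
    show ?thesis by (rule that[OF g(1)]) (use False g(2,3) in simp_all)
  qed
  have "\<exists>f. cut E f \<and> (\<forall>m. f (Out m) = False) \<and>
    (\<forall>\<mu> v. label \<mu> \<in> {label \<kappa>} \<longrightarrow> f (embed \<mu> v) = h v \<and> f (In \<mu> v) = h v) \<and>
    (\<forall>\<mu> v. label \<mu> \<notin> {label \<kappa>} \<and> contracts (\<lambda>_. False) (label \<mu>) \<longrightarrow>
      f (embed \<mu> v) = False \<and> f (In \<mu> v) = False)"
    by (rule extend[OF admissible_const]) (use True h in auto)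
  then obtain f where "cut E f" "\<forall>m. \<not> f (Out m)" "\<forall>v. f (In \<kappa> v) = h v"
    "\<forall>\<mu> v. label \<mu> \<noteq> label \<kappa> \<longrightarrow> \<not> f (In \<mu> v)"
    by (auto simp: contracts_def)
  then show thesis using that[of f] h(4) by blast
next
  case False
  show thesis
    by (rule that[OF private_inner_cut[OF False]]) auto
qed

lemma cut_on_label:
  assumes i: "i \<le> n" "i \<noteq> j" and g: "cut (Sub i) g"
  obtains f where "cut E f" "\<And>\<kappa> v. label \<kappa> = i \<Longrightarrow> f (embed \<kappa> v) = g v"
proof (cases "g initial = g final")
  case True
  have "\<exists>f. cut E f \<and> (\<forall>m. f (Out m) = g initial) \<and>
    (\<forall>\<mu> v. label \<mu> \<in> {i} \<longrightarrow> f (embed \<mu> v) = g v \<and> f (In \<mu> v) = g v) \<and>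
    (\<forall>\<mu> v. label \<mu> \<notin> {i} \<and> contracts (\<lambda>_. g initial) (label \<mu>) \<longrightarrow>
      f (embed \<mu> v) = g initial \<and> f (In \<mu> v) = g initial)"
    by (rule extend[OF admissible_const]) (use True i g in auto)
  then obtain f where "cut E f" "\<forall>\<kappa> v. label \<kappa> = i \<longrightarrow> f (embed \<kappa> v) = g v" by auto
  then show ?thesis using that[of f] by blast
next
  case False
  \<comment> \<open>\<open>H\<close> changes colour so that the edges with label \<open>i\<close>
    run from the colour of \<open>initial\<close> to that of \<open>final\<close>: between
    \<open>i - 1\<close> and \<open>i\<close> if \<open>i\<close> is positive; for
    \<open>i = 0\<close> the value at \<open>n\<close> suffices, as \<open>compl H\<close> has the
    opposite value at \<open>2 * n\<close>.\<close>
  define H where "H k = (if i = 0 then (if k = n then g initial else g final)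
    else if k < i then g initial else g final)" for k
  have H: "H n = (\<not> H 0)" using False i n3 by (auto simp: H_def)
  have edge: "g initial = compl H (src \<kappa>) \<and> g final = compl H (tgt \<kappa>)" if "label \<kappa> = i" for \<kappa>
  proof (cases "i = 0")
    case True
    then have "\<kappa> = 0" using that by (auto simp: label_def split: if_splits)
    moreover have "compl H n = g initial" using True by (simp add: compl_def H_def)
    moreover have "compl H (2 * n) = (\<not> H n)" using compl_add[OF H, of n] by (simp add: mult_2)
    moreover have "H n = g initial" using True by (simp add: H_def)
    ultimately show ?thesis using False by (simp add: src_def tgt_def)
  next
    case False
    then have "H (i - 1) = g initial" "H i = g final" by (simp_all add: H_def)
    moreover have "1 \<le> i" using False by simp
    ultimately show ?thesis using compl_edge[OF H _ i(1) that] \<open>g initial \<noteq> g final\<close>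
      by metis
  qed
  have "\<exists>f. cut E f \<and> (\<forall>m. f (Out m) = compl H m) \<and>
    (\<forall>\<mu> v. label \<mu> \<in> {i} \<longrightarrow> f (embed \<mu> v) = g v \<and> f (In \<mu> v) = g v) \<and>
    (\<forall>\<mu> v. label \<mu> \<notin> {i} \<and> contracts (compl H) (label \<mu>) \<longrightarrow>
      f (embed \<mu> v) = compl H (src \<mu>) \<and> f (In \<mu> v) = compl H (src \<mu>))"
    by (rule extend[OF admissible_compl[OF H]]) (use edge i g in auto)
  then obtain f where "cut E f" "\<forall>\<kappa> v. label \<kappa> = i \<longrightarrow> f (embed \<kappa> v) = g v" by auto
  then show ?thesis using that[of f] by blast
qed

lemma outer_cut:
  assumes "m < 2 * n" "m \<noteq> 0"
  obtains f where "cut E f" "\<not> f initial" "\<not> f final" "f (Out m)"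
proof -
  \<comment> \<open>Marking \<open>n\<close> makes \<open>H n\<close> differ from \<open>H 0\<close>
    and colours \<open>final\<close> with False. If \<open>m\<close> exceeds \<open>n\<close>, then
    \<open>m\<close> is coloured True because \<open>m - n\<close> is not marked.\<close>
  define H where "H k \<longleftrightarrow> k = m \<or> k = n" for k
  have H: "H n = (\<not> H 0)" using assms n3 by (auto simp: H_def)
  obtain f where f: "cut E f" "\<And>m. f (Out m) = compl H m"
    using extend_contracting[OF admissible_compl[OF H]] by blast
  show thesis
  proof (rule that[OF f(1)])
    show "\<not> f initial" "f (Out m)" using f(2) assms by (auto simp: compl_def H_def)
    have "compl H (2 * n) = (\<not> H n)" using compl_add[OF H, of n] by (simp add: mult_2)
    moreover have "H n" by (simp add: H_def)
    ultimately show "\<not> f final" using f(2) by simp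
  qed
qed

text \<open>All edges with such a label lie beyond the first \<open>j\<close> vertices and are
  contracted to False. \<open>right_cut\<close> does the same for the labels from 1 to
  \<open>j - 1\<close>, so every label other than \<open>j\<close> can be kept on one side while the
  ends are separated.\<close>

lemma left_cut:
  assumes "i = 0 \<or> j < i" "i \<le> n"
  obtains f where "cut E f" "f initial" "\<not> f final" "\<And>\<kappa> v. label \<kappa> = i \<Longrightarrow> \<not> f (embed \<kappa> v)"
proof -
  let ?F = "\<lambda>m. m < j"
  obtain f where f: "cut E f" "\<forall>m. f (Out m) = ?F m"
    "\<forall>\<kappa> v. contracts ?F (label \<kappa>) \<longrightarrow> f (embed \<kappa> v) = ?F (src \<kappa>)"
    using extend_contracting[OF admissible_left] by blast
  have edge: "\<not> src \<kappa> < j" "\<not> tgt \<kappa> < j" if "label \<kappa> = i" for \<kappa>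
    using that assms j by (auto simp: label_def src_def tgt_def split: if_splits)
  show thesis
  proof (rule that[OF f(1)])
    show "\<not> f (embed \<kappa> v)" if "label \<kappa> = i" for \<kappa> v
    proof -
      have "contracts ?F i" unfolding contracts_def using edge by simp
      then show ?thesis using f(3) edge[OF that] that by simp
    qed
  qed (use f(2) j in simp_all)
qed

lemma right_cut:
  assumes "1 \<le> i" "i < j"
  obtains f where "cut E f" "\<not> f initial" "f final" "\<And>\<kappa> v. label \<kappa> = i \<Longrightarrow> \<not> f (embed \<kappa> v)"
proof -
  let ?F = "\<lambda>m. n + j \<le> m"
  obtain f where f: "cut E f" "\<forall>m. f (Out m) = ?F m"
    "\<forall>\<kappa> v. contracts ?F (label \<kappa>) \<longrightarrow> f (embed \<kappa> v) = ?F (src \<kappa>)"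
    using extend_contracting[OF admissible_right] by blast
  have edge: "\<not> n + j \<le> src \<kappa>" "\<not> n + j \<le> tgt \<kappa>" if "label \<kappa> = i" for \<kappa>
    using that assms j by (auto simp: label_def src_def tgt_def split: if_splits)
  show thesis
  proof (rule that[OF f(1)])
    show "\<not> f (embed \<kappa> v)" if "label \<kappa> = i" for \<kappa> v
    proof -
      have "contracts ?F i" unfolding contracts_def using edge by simp
      then show ?thesis using f(3) edge[OF that] that by simp
    qed
  qed (use f(2) j in simp_all)
qed

lemma compl_cut:
  assumes "H n = (\<not> H 0)"
  obtains f where "cut E f" "\<And>m. f (Out m) = compl H m"
    "\<And>\<kappa> v. contracts (compl H) (label \<kappa>) \<Longrightarrow> f (In \<kappa> v) = compl H (src \<kappa>)"
  using extend_contracting[OF admissible_compl[of H, OF assms]] by blast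

section \<open>Separation of points\<close>

lemma copies_cut:
  assumes "label \<kappa> = label \<mu>" "label \<kappa> \<le> n" "\<kappa> \<noteq> \<mu>"
  obtains f where "cut E f" "f (In \<kappa> v) \<noteq> f (In \<mu> v)"
proof -
  define i where "i = label \<kappa>"
  have i: "1 \<le> i" "i \<le> n" "label \<kappa> = i" "label \<mu> = i"
    using assms by (auto simp: i_def label_def split: if_splits)
  \<comment> \<open>\<open>H\<close> has to be False at \<open>i - 1\<close> and \<open>i\<close>,
    so that edge \<open>i\<close> is contracted to False and edge \<open>n + i\<close> to True.
    Marking \<open>n\<close>, or \<open>0\<close> if \<open>i = n\<close>, makes \<open>H n\<close>
    and \<open>H 0\<close> differ without touching these two values.\<close>
  define H where "H k \<longleftrightarrow> (if i < n then k = n else k = 0)" for k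
  have H: "H n = (\<not> H 0)" using n3 by (simp add: H_def)
  have Hi: "\<not> H (i - 1)" "\<not> H i" using i(1,2) n3 by (auto simp: H_def)
  obtain f where f: "cut E f"
    "\<And>\<kappa> v. contracts (compl H) (label \<kappa>) \<Longrightarrow> f (In \<kappa> v) = compl H (src \<kappa>)"
    using compl_cut[of H, OF H] by metis
  have edge: "\<nu> = i \<and> \<not> compl H (src \<nu>) \<and> \<not> compl H (tgt \<nu>) \<or>
      \<nu> = n + i \<and> compl H (src \<nu>) \<and> compl H (tgt \<nu>)" if "label \<nu> = i" for \<nu>
    using compl_edge[OF H i(1,2) that] Hi by simp
  have "contracts (compl H) i" unfolding contracts_def using edge by blast
  then have "f (In \<kappa> v) = compl H (src \<kappa>)" "f (In \<mu> v) = compl H (src \<mu>)"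
    using f(2) i(3,4) by simp_all
  moreover have "compl H (src \<kappa>) \<noteq> compl H (src \<mu>)"
    using edge[OF i(3)] edge[OF i(4)] assms(3) by metis
  ultimately show thesis using that[OF f(1)] by simp
qed

lemma outer_separated_less:
  assumes "m < m'" "m' \<le> 2 * n"
  shows "\<exists>f. cut E f \<and> f (Out m) \<noteq> f (Out m')"
proof -
  have *: ?thesis if H: "H n = (\<not> H 0)" and "compl H m \<noteq> compl H m'" for H
    using compl_cut[of H, OF H] that(2) by metis
  consider "m = 0" "m' = 2 * n" | "m = 0" "m' < 2 * n" | "0 < m" "m' = 2 * n"
    | "0 < m" "m' < n" | "0 < m" "m < n" "n \<le> m'" "m' < 2 * n" | "m = n" "m' < 2 * n"
    | "n < m" "m' < 2 * n"
    using assms by linarith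
  then show ?thesis
  proof cases
    \<comment> \<open>Complementary colourings give \<open>0\<close> and \<open>2 * n\<close> the
      same colour; only this pair needs the free label.\<close>
    case 1
    then show ?thesis using left_cut[of 0] by (metis le0)
  next
    case 2
    then show ?thesis using outer_cut[of m'] assms(1) by (metis less_nat_zero_code)
  next
    case 3
    then show ?thesis using outer_cut[of m] assms(1) by (metis less_nat_zero_code)
  next
    case 4
    show ?thesis
      by (rule *[of "\<lambda>k. k = m \<or> k = n"]) (use 4 assms(1) in \<open>simp_all add: compl_def\<close>)
  next
    case 5
    show ?thesis
      by (rule *[of "\<lambda>k. k = n"]) (use 5 n3 in \<open>auto simp add: compl_def\<close>)
  next
    case 6
    show ?thesis
      by (rule *[of "\<lambda>k. k \<noteq> 0"]) (use 6 assms(1) n3 in \<open>auto simp add: compl_def\<close>)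
  next
    case 7
    show ?thesis
      by (rule *[of "\<lambda>k. k = m - n \<or> k = n"]) (use 7 assms(1) n3 in \<open>auto simp add: compl_def\<close>)
  qed
qed

lemma outer_separated:
  assumes "m \<noteq> m'"
  shows "\<exists>f. cut E f \<and> f (Out m) \<noteq> f (Out m')"
proof -
  consider "2 * n < m" | "2 * n < m'" | "m < m'" "m' \<le> 2 * n" | "m' < m" "m \<le> 2 * n"
    using assms by linarith
  then show ?thesis
  proof cases
    case 1
    then show ?thesis using private_outer_cut assms by (intro exI[of _ "\<lambda>x. x = Out m"]) simp
  next
    case 2
    then show ?thesis using private_outer_cut assms by (intro exI[of _ "\<lambda>x. x = Out m'"]) simp
  next
    case 3
    then show ?thesis by (rule outer_separated_less)
  next
    case 4
    from outer_separated_less[OF this] show ?thesis by (metis (full_types))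
  qed
qed

lemma inner_separated:
  assumes "In \<kappa> v \<noteq> In \<mu> w" "label \<kappa> = label \<mu>"
  shows "\<exists>f. cut E f \<and> f (In \<kappa> v) \<noteq> f (In \<mu> w)"
proof -
  let ?private = "\<lambda>\<kappa> v. \<not> (label \<kappa> \<le> n \<and> label \<kappa> \<noteq> j \<and> v \<noteq> initial \<and> v \<noteq> final)"
  consider "?private \<kappa> v" | "?private \<mu> w" | "\<not> ?private \<kappa> v" "\<not> ?private \<mu> w" "v \<noteq> w"
    | "\<not> ?private \<kappa> v" "\<not> ?private \<mu> w" "v = w"
    by argo
  then show ?thesis
  proof cases
    case 1
    from private_inner_cut[OF this] show ?thesis
      using assms(1) by (intro exI[of _ "\<lambda>x. x = In \<kappa> v"] conjI) auto
  next
    case 2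
    from private_inner_cut[OF this] show ?thesis
      using assms(1) by (intro exI[of _ "\<lambda>x. x = In \<mu> w"] conjI) auto
  next
    case 3
    define i where "i = label \<kappa>"
    obtain g where g: "cut (Sub i) g" "g v = True" "g w = (\<not> True)"
      using separating_cut[of i v w True] 3 unfolding i_def by metis
    obtain f where f: "cut E f" "\<And>\<kappa> v. label \<kappa> = i \<Longrightarrow> f (embed \<kappa> v) = g v"
      using cut_on_label[OF _ _ g(1)] 3(1) unfolding i_def by metis
    have "embed \<kappa> v = In \<kappa> v" "embed \<mu> w = In \<mu> w" using 3(1,2) by (simp_all add: embed_def)
    then have "f (In \<kappa> v) = g v" "f (In \<mu> w) = g w"
      using f(2)[of \<kappa> v] f(2)[of \<mu> w] assms(2) by (simp_all add: i_def)
    then show ?thesis using f(1) g(2,3) by (intro exI[of _ f]) simp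
  next
    case 4
    have "label \<kappa> \<le> n" "\<kappa> \<noteq> \<mu>" using 4 assms(1) by simp_all
    from copies_cut[OF assms(2) this, of v] show ?thesis using 4(3) by metis
  qed
qed

lemma separated:
  assumes "p \<noteq> q"
  shows "\<exists>f. cut E f \<and> f p \<noteq> f q"
proof (cases p)
  case p: (Out m)
  show ?thesis
  proof (cases q)
    case (Out m')
    then show ?thesis using outer_separated[of m m'] assms p by simp
  next
    case (In \<mu> w)
    then show ?thesis using inner_cut[of \<mu> w] p by metis
  qed
next
  case p: (In \<kappa> v)
  show ?thesis
  proof (cases q)
    case (Out m')
    then show ?thesis using inner_cut[of \<kappa> v] p by metis
  next
    case q: (In \<mu> w)
    show ?thesis
    proof (cases "label \<kappa> = label \<mu>")
      case True
      then show ?thesis using inner_separated[of \<kappa> v \<mu> w] assms p q by simp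
    next
      case False
      then show ?thesis using inner_cut[of \<kappa> v] p q by metis
    qed
  qed
qed

lemma noncrossing:
  assumes "p \<noteq> initial" "p \<noteq> final"
  shows "\<exists>f. cut E f \<and> f initial = f final \<and> f p \<noteq> f initial"
proof (cases p)
  case (Out m)
  then consider "2 * n < m" | "m < 2 * n" "m \<noteq> 0" using assms by fastforce
  then show ?thesis
  proof cases
    case 1
    then show ?thesis
      using private_outer_cut assms Out by (intro exI[of _ "\<lambda>x. x = Out m"]) auto
  next
    case 2
    then show ?thesis using outer_cut[of m] Out by metis
  qed
next
  case (In \<kappa> v)
  then show ?thesis using inner_cut[of \<kappa> v] by metis
qed

lemma crossing:
  assumes "\<alpha> \<in> E"
  shows "\<exists>f. cut E f \<and> f initial \<noteq> f final \<and> rel_image f \<alpha> \<noteq> Id"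
proof -
  have *: ?thesis if "cut E f" "f initial \<noteq> f final" "rel_image f \<alpha> \<in> thin" for f
    using that Id_bool_not_thin by metis
  consider "\<alpha> \<in> thin" | i \<beta> where "i \<le> n" "i \<noteq> j" "\<alpha> = lift i \<beta>"
    using E_cases[OF assms] by blast
  then show ?thesis
  proof cases
    case 1
    then have "rel_image f \<alpha> \<in> thin" for f :: "vertex \<Rightarrow> bool" by (rule rel_image_thin)
    then show ?thesis using left_cut[of 0] * by (metis le0)
  next
    case (2 i \<beta>)
    have thin: "rel_image f \<alpha> \<in> thin" if "\<And>\<kappa> v. label \<kappa> = i \<Longrightarrow> \<not> f (embed \<kappa> v)" for f
    proof -
      have "rel_image f \<alpha> \<subseteq> {(False, False)}"
        unfolding 2(3) rel_image_def lift_def using that by auto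
      then show ?thesis by (rule subset_single_thin)
    qed
    consider "i = 0 \<or> j < i" | "1 \<le> i" "i < j" using 2(2) by linarith
    then show ?thesis
    proof cases
      case 1
      from left_cut[OF this 2(1)] show ?thesis using * thin by metis
    next
      case 2
      from right_cut[OF this] show ?thesis using * thin by metis
    qed
  qed
qed

section \<open>Cuts that detect undefinedness\<close>

text \<open>Besides the prescribed crossing, the only constraint is that \<open>H 0\<close> and
  \<open>H n\<close> differ. It forces the colour of vertex \<open>0\<close> if \<open>i\<close> is
  \<open>0\<close> or \<open>n\<close>, because then \<open>H n\<close> is prescribed, and that of
  \<open>2 * n\<close> if \<open>i = 1\<close>, because then \<open>H 0\<close> is prescribed; the
  last two assumptions exclude these positions.\<close>

lemma crossing_colouring:
  assumes i: "i \<le> n" and m: "m \<le> 2 * n"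
    and ends: "\<And>\<kappa>. label \<kappa> = i \<Longrightarrow> m \<noteq> src \<kappa> \<and> m \<noteq> tgt \<kappa>"
    and m0: "m = 0 \<Longrightarrow> i \<noteq> 0 \<and> i \<noteq> n" and m2n: "m = 2 * n \<Longrightarrow> i \<noteq> 1"
  shows "\<exists>H. H n = (\<not> H 0) \<and> compl H m = c \<and>
    (\<forall>\<kappa>. label \<kappa> = i \<longrightarrow> compl H (src \<kappa>) = a \<and> compl H (tgt \<kappa>) = (\<not> a))"
proof (cases "i = 0")
  case True
  have mm: "m \<noteq> n" "m \<noteq> 2 * n" "m \<noteq> 0"
    using ends[of 0] m0 True by (auto simp: label_def src_def tgt_def)
  define H where "H k = (if k = n then a else if k = 0 then \<not> a else if m \<le> n then c else \<not> c)" for k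
  have H: "H n = (\<not> H 0)" using n3 by (simp add: H_def)
  have edge: "compl H (src \<kappa>) = a \<and> compl H (tgt \<kappa>) = (\<not> a)" if "label \<kappa> = i" for \<kappa>
  proof -
    have "src \<kappa> = n" "tgt \<kappa> = 2 * n"
      using that True by (auto simp: label_def src_def tgt_def split: if_splits)
    moreover have "compl H n = a" using compl_le[of n H] by (simp add: H_def)
    moreover have "compl H (2 * n) = (\<not> H n)" using compl_add[OF H, of n] by (simp add: mult_2)
    moreover have "H n = a" by (simp add: H_def)
    ultimately show ?thesis by simp
  qed
  have "compl H m = c"
  proof (cases "m \<le> n")
    case True
    then show ?thesis using mm by (simp add: compl_def H_def)
  next
    case False
    then have "m - n \<noteq> n" "m - n \<noteq> 0" using mm by auto
    then show ?thesis using False by (simp add: compl_def H_def)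
  qed
  then show ?thesis using H edge by blast
next
  case False
  then have i1: "1 \<le> i" by simp
  have mm: "m \<noteq> i - 1" "m \<noteq> i" "m \<noteq> n + i" "m \<noteq> n + i - 1"
    using ends[of i] ends[of "n + i"] i i1 by (simp_all add: label_def src_def tgt_def)
  \<comment> \<open>Where the crossing leaves \<open>0\<close> and \<open>n\<close> free they get
    opposite values, chosen so that \<open>m\<close> has colour \<open>c\<close> even if
    \<open>m\<close> is \<open>0\<close>, \<open>n\<close> or \<open>2 * n\<close>. Elsewhere the
    value is \<open>c\<close> or its negation according to the half that contains
    \<open>m\<close>.\<close>
  define H where "H k = (if k = i - 1 then a else if k = i then \<not> a
    else if k = n then (if i = 1 then \<not> a else if m = n then c else \<not> c)
    else if k = 0 then (if i = n then a else if m = n then \<not> c else c)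
    else if m \<le> n then c else \<not> c)" for k
  have H: "H n = (\<not> H 0)"
  proof -
    consider "i = 1" | "i = n" | "1 < i" "i < n" using i i1 by linarith
    then show ?thesis
    proof cases
      case 3
      then show ?thesis using n3 by (auto simp: H_def)
    qed (use n3 in \<open>simp_all add: H_def\<close>)
  qed
  have Hi: "H (i - 1) = a" "H i = (\<not> a)" using i1 by (simp_all add: H_def)
  have edge: "compl H (src \<kappa>) = a \<and> compl H (tgt \<kappa>) = (\<not> a)" if "label \<kappa> = i" for \<kappa>
    using compl_edge[OF H i1 i that] unfolding Hi not_not by blast
  have "compl H m = c"
  proof (cases "m \<le> n")
    case True
    have "H m = c"
    proof -
      consider "m = n" | "m = 0" | "0 < m" "m < n" using True by linarith
      then show ?thesis
      proof cases
        case 1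
        then have "i \<noteq> 1" using mm by auto
        then show ?thesis using 1 mm by (simp add: H_def)
      next
        case 2
        then show ?thesis using mm m0 n3 by (simp add: H_def)
      next
        case 3
        then show ?thesis using mm by (simp add: H_def)
      qed
    qed
    then show ?thesis using compl_le[OF True] by simp
  next
    case False
    define k where "k = m - n"
    have k: "m = n + k" "0 < k" "k \<le> n" "k \<noteq> i" "k \<noteq> i - 1"
      using False m mm i1 by (auto simp: k_def)
    have "H k = (\<not> c)"
    proof (cases "k = n")
      case True
      then have "i \<noteq> 1" using m2n k(1) by auto
      then show ?thesis using True k by (simp add: H_def)
    next
      case kn: False
      then show ?thesis using k by (simp add: H_def)
    qed
    then show ?thesis using compl_add[OF H, of k] k(1) by simp
  qed
  then show ?thesis using H edge by blast
qed

text \<open>By the fourth condition of \<open>good\<close>, some crossing cut gives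
  \<open>\<beta>\<close> a thin image, whose domain misses a colour. That colour is given to
  \<open>m\<close>, which a crossing of the edges with label \<open>i\<close> leaves free.\<close>

lemma outer_Domain_cut:
  assumes i: "i \<le> n" "i \<noteq> j" and \<beta>: "\<beta> \<in> Sub i" and m: "m \<le> 2 * n"
    and ends: "\<And>\<kappa>. label \<kappa> = i \<Longrightarrow> m \<noteq> src \<kappa> \<and> m \<noteq> tgt \<kappa>"
    and m0: "m = 0 \<Longrightarrow> i \<noteq> 0 \<and> i \<noteq> n" and m2n: "m = 2 * n \<Longrightarrow> i \<noteq> 1"
  shows "\<exists>f. cut E f \<and> f (Out m) \<notin> Domain (rel_image f (lift i \<beta>))"
proof -
  obtain g where g: "cut (Sub i) g" "g initial \<noteq> g final" "rel_image g \<beta> \<noteq> Id"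
    using good_crossing[OF good_Sub[OF i(1)] \<beta>] by blast
  have "rel_image g \<beta> \<in> thin" using g(1,3) \<beta> unfolding cut_def B21_rel_def by blast
  from thin_Domain[OF this] obtain b where b: "Domain (rel_image g \<beta>) \<subseteq> {b}" by (rule exE)
  have "\<exists>H. H n = (\<not> H 0) \<and> compl H m = (\<not> b) \<and> (\<forall>\<kappa>. label \<kappa> = i \<longrightarrow>
      compl H (src \<kappa>) = g initial \<and> compl H (tgt \<kappa>) = (\<not> g initial))"
    by (rule crossing_colouring[OF i(1) m], erule ends, erule m0, erule m2n)
  then obtain H where H: "H n = (\<not> H 0)" "compl H m = (\<not> b)"
    "\<forall>\<kappa>. label \<kappa> = i \<longrightarrow> compl H (src \<kappa>) = g initial \<and> compl H (tgt \<kappa>) = (\<not> g initial)"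
    by (elim exE conjE)
  have I: "label \<kappa> \<le> n \<and> label \<kappa> \<noteq> j \<and> cut (Sub (label \<kappa>)) g \<and>
      g initial = compl H (src \<kappa>) \<and> g final = compl H (tgt \<kappa>)" if "label \<kappa> \<in> {i}" for \<kappa>
    using that H(3)[rule_format, of \<kappa>] g(1,2) i by simp
  have "\<exists>f. cut E f \<and> (\<forall>m. f (Out m) = compl H m) \<and>
    (\<forall>\<mu> v. label \<mu> \<in> {i} \<longrightarrow> f (embed \<mu> v) = g v \<and> f (In \<mu> v) = g v) \<and>
    (\<forall>\<mu> v. label \<mu> \<notin> {i} \<and> contracts (compl H) (label \<mu>) \<longrightarrow>
      f (embed \<mu> v) = compl H (src \<mu>) \<and> f (In \<mu> v) = compl H (src \<mu>))"
    by (rule extend[OF admissible_compl[of H, OF H(1)]]) (erule I)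
  then obtain f where f: "cut E f \<and> (\<forall>m. f (Out m) = compl H m) \<and>
    (\<forall>\<mu> v. label \<mu> \<in> {i} \<longrightarrow> f (embed \<mu> v) = g v \<and> f (In \<mu> v) = g v) \<and>
    (\<forall>\<mu> v. label \<mu> \<notin> {i} \<and> contracts (compl H) (label \<mu>) \<longrightarrow>
      f (embed \<mu> v) = compl H (src \<mu>) \<and> f (In \<mu> v) = compl H (src \<mu>))"
    by (rule exE)
  have fm: "f (Out m) = (\<not> b)" using f H(2) by simp
  have fv: "f (embed \<mu> v) = g v" if "label \<mu> = i" for \<mu> v using f that by simp
  have "rel_image f (lift i \<beta>) = rel_image g \<beta>" using i(1) fv by (rule rel_image_lift_eq)
  moreover have "f (Out m) \<notin> Domain (rel_image g \<beta>)"
  proof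
    assume "f (Out m) \<in> Domain (rel_image g \<beta>)"
    from subsetD[OF b this] fm show False by simp
  qed
  ultimately show ?thesis using f by (intro exI[of _ f]) simp
qed

lemma Domain_lift_cut:
  assumes i: "i \<le> n" "i \<noteq> j" and \<beta>: "\<beta> \<in> Sub i" and p: "p \<notin> Domain (lift i \<beta>)"
  shows "\<exists>f. cut E f \<and> f p \<notin> Domain (rel_image f (lift i \<beta>))"
proof -
  have avoid: ?thesis if "cut E f" "f p" "\<And>\<kappa> v. label \<kappa> = i \<Longrightarrow> \<not> f (embed \<kappa> v)" for f
  proof -
    have "f p \<notin> Domain (rel_image f (lift i \<beta>))"
      unfolding Domain_rel_image using that(2,3) by (auto simp: lift_def)
    then show ?thesis using that(1) by blast
  qed
  show ?thesis
  proof (cases "\<exists>\<kappa> v. label \<kappa> = i \<and> p = embed \<kappa> v")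
    case True
    then obtain \<kappa> v where \<kappa>: "label \<kappa> = i" "p = embed \<kappa> v" by blast
    have "v \<notin> Domain \<beta>" using p \<kappa> unfolding lift_def by blast
    then obtain g where g: "cut (Sub i) g" "g v \<notin> Domain (rel_image g \<beta>)"
      using good_Domain[OF good_Sub[OF i(1)] \<beta>] by blast
    obtain f where f: "cut E f" "\<And>\<kappa> v. label \<kappa> = i \<Longrightarrow> f (embed \<kappa> v) = g v"
      using cut_on_label[OF i g(1)] by metis
    have "rel_image f (lift i \<beta>) = rel_image g \<beta>" using i(1) f(2) by (rule rel_image_lift_eq)
    then show ?thesis using f g(2) \<kappa> by (intro exI[of _ f]) simp
  next
    case out: False
    then have out': "embed \<kappa> v \<noteq> p" if "label \<kappa> = i" for \<kappa> v using that by blast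
    show ?thesis
    proof (cases p)
      case p: (In \<mu> w)
      show ?thesis
      proof (cases "label \<mu> = i")
        case True
        have "w = initial \<or> w = final"
        proof (rule ccontr)
          assume "\<not> (w = initial \<or> w = final)"
          then have "p = embed \<mu> w" using p by (simp add: embed_def)
          then show False using out True by blast
        qed
        then have "cut E (\<lambda>x. x = In \<mu> w)" by (intro private_inner_cut) blast
        then show ?thesis by (rule avoid) (use out' p in simp_all)
      next
        case False
        obtain f where f: "cut E f" "f (In \<mu> w)" "\<And>m. \<not> f (Out m)"
          "\<And>\<kappa> v. label \<kappa> \<noteq> label \<mu> \<Longrightarrow> \<not> f (In \<kappa> v)"
          using inner_cut[of \<mu> w] by metis
        show ?thesis
          by (rule avoid[OF f(1)]) (use f(2-4) p False in \<open>auto simp: embed_def\<close>)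
      qed
    next
      case p: (Out m)
      have ends: "m \<noteq> src \<kappa> \<and> m \<noteq> tgt \<kappa>" if "label \<kappa> = i" for \<kappa>
      proof -
        have "embed \<kappa> initial = Out (src \<kappa>)" "embed \<kappa> final = Out (tgt \<kappa>)"
          using initial_neq_final by (auto simp: embed_def)
        then show ?thesis using out p that by metis
      qed
      \<comment> \<open>The second and third alternatives are the forced positions of
        \<open>crossing_colouring\<close>. There the free label provides a cut with \<open>p\<close>
        opposite to all copies with label \<open>i\<close>.\<close>
      consider "2 * n < m" | "m = 0" "i = 0 \<or> i = n" | "m = 2 * n" "i = 1"
        | "m \<le> 2 * n" "m = 0 \<longrightarrow> i \<noteq> 0 \<and> i \<noteq> n" "m = 2 * n \<longrightarrow> i \<noteq> 1"
        by linarith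
      then show ?thesis
      proof cases
        case 1
        from private_outer_cut[OF this] show ?thesis by (rule avoid) (use out' p in simp_all)
      next
        case 2
        then have "i = 0 \<or> j < i" using i j by linarith
        from left_cut[OF this i(1)] show ?thesis using avoid p 2(1) by metis
      next
        case 3
        then have "1 \<le> i" "i < j" using i j by linarith+
        from right_cut[OF this] show ?thesis using avoid p 3(1) by metis
      next
        case 4
        have "\<exists>f. cut E f \<and> f (Out m) \<notin> Domain (rel_image f (lift i \<beta>))"
          by (rule outer_Domain_cut[OF i \<beta> 4(1) ends]) (use 4 in simp_all)
        then show ?thesis unfolding p .
      qed
    qed
  qed
qed

lemma good_E: "good E"
  unfolding good_def
proof (intro conjI allI ballI impI)
  show "\<exists>f. cut E f \<and> f p \<noteq> f q" if "p \<noteq> q" for p q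
    using that by (rule separated)
  show "\<exists>f. cut E f \<and> f initial = f final \<and> f p \<noteq> f initial" if "p \<noteq> initial \<and> p \<noteq> final" for p
    using that noncrossing by blast
  show "\<exists>f. cut E f \<and> f initial \<noteq> f final \<and> rel_image f \<alpha> \<noteq> Id" if "\<alpha> \<in> E" for \<alpha>
    using that by (rule crossing)
  show "\<exists>f. cut E f \<and> f p \<notin> Domain (rel_image f \<alpha>)" if \<alpha>: "\<alpha> \<in> E" and p: "p \<notin> Domain \<alpha>"
    for \<alpha> p
  proof -
    consider "\<alpha> = {}" | a b where "\<alpha> = {(a, b)}"
      | i \<beta> where "i \<le> n" "i \<noteq> j" "\<beta> \<in> Sub i" "\<alpha> = lift i \<beta>"
      using E_cases[OF \<alpha>] unfolding thin_def by blast
    then show ?thesis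
    proof cases
      case 1
      obtain f where "cut E f" using separated[OF initial_neq_final] by blast
      then show ?thesis unfolding Domain_rel_image 1 by auto
    next
      case (2 a b)
      then have "p \<noteq> a" using p by auto
      from separated[OF this] show ?thesis unfolding Domain_rel_image 2 by simp
    next
      case (3 i \<beta>)
      then show ?thesis using Domain_lift_cut p by simp
    qed
  qed
qed

end

context iterated_graph
begin

text \<open>Injectivity of \<open>lift i\<close> makes \<open>Sub i\<close> no larger than
  \<open>E\<close>, so the bound passes down to the next level. One label is selected for each
  element of \<open>E\<close>, and fewer than \<open>n\<close> elements cannot use up the labels
  from 1 to \<open>n\<close>; a missing one serves as \<open>j\<close>.\<close>

lemma good_subset_tower: "E \<subseteq> tower h \<Longrightarrow> finite E \<Longrightarrow> card E < n \<Longrightarrow> good E"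
proof (induction h arbitrary: E)
  case 0
  then show ?case by (simp add: good_thin)
next
  case (Suc h)
  define Sub where "Sub i = {\<beta> \<in> tower h. lift i \<beta> \<in> E}" for i
  have "good (Sub i)" if "i \<le> n" for i
  proof (rule Suc.IH)
    have inj: "inj_on (lift i) (Sub i)" by (rule inj_onI) (rule lift_inject[OF that])
    have sub: "lift i ` Sub i \<subseteq> E" by (auto simp: Sub_def)
    show "Sub i \<subseteq> tower h" by (auto simp: Sub_def)
    show "finite (Sub i)" using inj_on_finite[OF inj sub Suc.prems(2)] .
    show "card (Sub i) < n"
      using card_inj_on_le[OF inj sub Suc.prems(2)] Suc.prems(3) by simp
  qed
  moreover define lab where "lab \<alpha> = (SOME i. i \<le> n \<and> (\<exists>\<beta>\<in>tower h. \<alpha> = lift i \<beta>))" for \<alpha>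
  have "\<not> {1..n} \<subseteq> lab ` E"
  proof
    assume "{1..n} \<subseteq> lab ` E"
    then have "card {1..n} \<le> card (lab ` E)" using Suc.prems(2) by (intro card_mono) simp_all
    also have "\<dots> \<le> card E" using Suc.prems(2) by (rule card_image_le)
    finally show False using Suc.prems(3) by simp
  qed
  then obtain j where "j \<in> {1..n}" and j_lab: "j \<notin> lab ` E" by blast
  then have j: "1 \<le> j" "j \<le> n" by simp_all
  have "\<alpha> \<in> thin \<or> (\<exists>i \<beta>. i \<le> n \<and> i \<noteq> j \<and> \<beta> \<in> Sub i \<and> \<alpha> = lift i \<beta>)" if "\<alpha> \<in> E" for \<alpha>
  proof (cases "\<alpha> \<in> thin")
    case False
    moreover have "\<alpha> \<in> tower (Suc h)" using that Suc.prems(1) by blast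
    ultimately obtain i \<beta> where "i \<le> n" "\<beta> \<in> tower h" "\<alpha> = lift i \<beta>" by auto
    then have "\<exists>i. i \<le> n \<and> (\<exists>\<beta>\<in>tower h. \<alpha> = lift i \<beta>)" by blast
    then have "lab \<alpha> \<le> n \<and> (\<exists>\<beta>\<in>tower h. \<alpha> = lift (lab \<alpha>) \<beta>)"
      unfolding lab_def by (rule someI_ex)
    then obtain \<beta> where *: "lab \<alpha> \<le> n" "\<beta> \<in> tower h" "\<alpha> = lift (lab \<alpha>) \<beta>" by blast
    have "\<beta> \<in> Sub (lab \<alpha>)" using that * by (simp add: Sub_def)
    moreover have "lab \<alpha> \<noteq> j" using that j_lab by blast
    ultimately show ?thesis using *(1,3) by blast
  qed simp
  ultimately interpret level n E Sub j
    using j by unfold_locales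
  show ?case by (rule good_E)
qed

text \<open>Each value of a variable and its converse have to be covered, hence the factor 2; the remaining summand
  pays for the value \<open>{}\<close> given to the variables that do not occur.\<close>

lemma tower_identity:
  assumes e: "e \<in> identities B21"
    and card: "2 * card (set_uterm (fst e) \<union> set_uterm (snd e)) + 2 < n"
  shows "e \<in> identities (rel_algebra (tower h))"
proof -
  define V where "V = set_uterm (fst e) \<union> set_uterm (snd e)"
  have "finite (set_uterm t)" for t :: "nat uterm" by (induction t) simp_all
  then have "finite V" unfolding V_def by simp
  have "eval (rel_algebra (tower h)) \<phi> (fst e) = eval (rel_algebra (tower h)) \<phi> (snd e)"
    if \<phi>: "\<forall>x. \<phi> x \<in> tower h" for \<phi>
  proof -
    define \<psi> where "\<psi> x = (if x \<in> V then \<phi> x else {})" for x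
    define E where "E = range \<psi> \<union> converse ` range \<psi>"
    have range: "range \<psi> \<subseteq> insert {} (\<phi> ` V)" by (auto simp: \<psi>_def)
    then have fin: "finite (range \<psi>)" using \<open>finite V\<close> by (auto intro: finite_subset)
    have "card (range \<psi>) \<le> card (insert {} (\<phi> ` V))"
      using range \<open>finite V\<close> by (intro card_mono) simp_all
    also have "\<dots> \<le> Suc (card (\<phi> ` V))" by (rule card_insert_le_m1) simp_all
    also have "\<dots> \<le> Suc (card V)" using card_image_le[OF \<open>finite V\<close>] by simp
    finally have "card (range \<psi>) \<le> Suc (card V)" .
    moreover have "card E \<le> card (range \<psi>) + card (converse ` range \<psi>)"
      unfolding E_def by (rule card_Un_le)
    moreover have "card (converse ` range \<psi>) \<le> card (range \<psi>)" using fin by (rule card_image_le)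
    ultimately have "card E < n" using card unfolding V_def by linarith
    moreover have "{} \<in> tower h" using thin_subset_tower thin_empty by blast
    then have "\<psi> x \<in> tower h" for x using \<phi> by (simp add: \<psi>_def)
    then have "E \<subseteq> tower h" unfolding E_def using tower_converse by auto
    moreover have "finite E" unfolding E_def using fin by simp
    ultimately have good: "good E" using good_subset_tower by blast
    have mono: "cut (range \<psi>) f" if "cut E f" for f
      using that unfolding cut_def E_def by blast
    have "eval (rel_algebra (tower h)) \<psi> (fst e) = eval (rel_algebra (tower h)) \<psi> (snd e)"
    proof (rule cuts_imp_identity[OF e])
      show "\<exists>f. cut (range \<psi>) f \<and> f p \<noteq> f q" if "p \<noteq> q" for p q
        using good_separated[OF good that] mono by blast
      show "\<exists>f. cut (range \<psi>) f \<and> f p \<notin> Domain (rel_image f (\<psi> x))" if "p \<notin> Domain (\<psi> x)" for x p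
        using good_Domain[OF good _ that] mono unfolding E_def by blast
      show "\<exists>f. cut (range \<psi>) f \<and> f p \<notin> Range (rel_image f (\<psi> x))" if "p \<notin> Range (\<psi> x)" for x p
      proof -
        have "(\<psi> x)\<inverse> \<in> E" "p \<notin> Domain ((\<psi> x)\<inverse>)" using that by (auto simp: E_def)
        from good_Domain[OF good this] show ?thesis
          using mono unfolding rel_image_converse Domain_converse by blast
      qed
    qed
    moreover have "eval (rel_algebra (tower h)) \<phi> t = eval (rel_algebra (tower h)) \<psi> t"
      if "set_uterm t \<subseteq> V" for t
      using that by (induction t) (simp_all add: \<psi>_def)
    ultimately show ?thesis by (simp add: V_def)
  qed
  then show ?thesis by (simp add: identities_def satisfies_def)
qed

end

section \<open>Values of the words in the tower\<close>

text \<open>The empty word gets the value \<open>Id\<close>, in contrast to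
  \<open>word_eval\<close>, so that concatenation is composition without exceptions.\<close>

primrec path :: "('x \<Rightarrow> 'v rel) \<Rightarrow> 'x list \<Rightarrow> 'v rel" where
  "path \<phi> [] = Id"
| "path \<phi> (x # w) = \<phi> x O path \<phi> w"

lemma path_append: "path \<phi> (u @ w) = path \<phi> u O path \<phi> w"
  by (induction u) (simp_all add: O_assoc)

lemma path_map: "path \<phi> (map g w) = path (\<lambda>x. \<phi> (g x)) w"
  by (induction w) simp_all

lemma word_eval_path: "w \<noteq> [] \<Longrightarrow> word_eval (rel_algebra T) \<phi> w = path \<phi> w"
  by (induction "rel_algebra T" \<phi> w rule: word_eval.induct) simp_all

fun word_term :: "'v list \<Rightarrow> 'v uterm" where
  "word_term [] = undefined"
| "word_term [x] = Var x"
| "word_term (x # y # w) = Mult (Var x) (word_term (y # w))"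

lemma eval_word_term: "w \<noteq> [] \<Longrightarrow> eval A \<phi> (word_term w) = word_eval A \<phi> w"
  by (induction w rule: word_term.induct) simp_all

lemma word_eval_map: "w \<noteq> [] \<Longrightarrow> word_eval A \<phi> (map g w) = word_eval A (\<lambda>x. \<phi> (g x)) w"
  by (induction w rule: word_term.induct) simp_all

text \<open>The variables of \<open>v_word\<close> are lists, those of \<open>identities\<close> are
  natural numbers; \<open>to_nat\<close> renames the former injectively.\<close>

lemma reduct_satisfies_transfer:
  fixes A :: "'a algebra21" and B :: "'b algebra21" and u w :: "'v::countable list"
  assumes "reduct_satisfies A u w" "identities A \<subseteq> identities B" "u \<noteq> []" "w \<noteq> []"
  shows "reduct_satisfies B u w"
proof -
  define t where "t v = word_term (map to_nat v)" for v :: "'v list"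
  have t: "eval B \<phi> (t v) = word_eval B (\<lambda>x. \<phi> (to_nat x)) v" if "v \<noteq> []" for \<phi> v
    using that by (simp add: t_def eval_word_term word_eval_map)
  have "(t u, t w) \<in> identities A"
    using assms(1,3,4) by (simp add: identities_def satisfies_def reduct_satisfies_def t_def
      eval_word_term word_eval_map)
  then have *: "satisfies B (t u, t w)" using assms(2) by (auto simp: identities_def)
  show ?thesis
    unfolding reduct_satisfies_def
  proof (intro allI impI)
    fix \<phi> :: "'v \<Rightarrow> 'b" assume \<phi>: "\<forall>x. \<phi> x \<in> carrier B"
    have "eval B (\<lambda>i. \<phi> (from_nat i)) (t u) = eval B (\<lambda>i. \<phi> (from_nat i)) (t w)"
      using * \<phi> by (simp add: satisfies_def)
    then show "word_eval B \<phi> u = word_eval B \<phi> w" using assms(3,4) by (simp add: t)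
  qed
qed

context iterated_graph
begin

text \<open>\<open>v_word\<close> appends each new index, so the last index selects the outer label
  and the remaining ones act inside the copy. Index \<open>n + 1\<close> runs along edge 0 and
  larger indices fix \<open>final\<close>; together they read the right factor as one edge.\<close>

primrec letter :: "nat \<Rightarrow> nat list \<Rightarrow> vertex rel" where
  "letter 0 l = {(initial, final)}"
| "letter (Suc h) l = (if last l \<le> n then lift (last l) (letter h (butlast l))
    else if last l = n + 1 then lift 0 (letter h (butlast l)) else {(final, final)})"

lemma letter_in_tower: "letter h l \<in> tower h"
proof (induction h arbitrary: l)
  case (Suc h)
  have "lift i (letter h (butlast l)) \<in> tower (Suc h)" if "i \<le> n" for i
    using that Suc by auto
  moreover have "{(final, final)} \<in> tower (Suc h)" by simp
  ultimately show ?case by simp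
qed simp

lemma lift_path_subset: "w \<noteq> [] \<Longrightarrow> lift i (path \<phi> w) \<subseteq> path (\<lambda>x. lift i (\<phi> x)) w"
proof (induction w rule: list_nonempty_induct)
  case (cons x w)
  have "lift i (\<phi> x O path \<phi> w) \<subseteq> lift i (\<phi> x) O lift i (path \<phi> w)"
    by (rule lift_relcomp_subset)
  also have "\<dots> \<subseteq> lift i (\<phi> x) O path (\<lambda>x. lift i (\<phi> x)) w"
    using cons.IH by (rule relcomp_mono[OF subset_refl])
  finally show ?case by simp
qed simp

text \<open>The first pass leads from \<open>0\<close> through \<open>n\<close> to
  \<open>2 * n\<close>. Every repetition descends from \<open>2 * n\<close> to \<open>n\<close> and
  returns along edge 0, so the exponent does not affect the end point.\<close>

lemma path_v_pattern:
  assumes up: "\<And>j. 1 \<le> j \<Longrightarrow> j \<le> n \<Longrightarrow> (Out (j - 1), Out j) \<in> path \<phi> (W j)"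
    and down: "\<And>j. 1 \<le> j \<Longrightarrow> j \<le> n \<Longrightarrow> (Out (n + j), Out (n + j - 1)) \<in> path \<phi> (W j)"
    and right: "(Out n, final) \<in> path \<phi> (W (n + 1))"
    and loop: "\<And>j. n + 1 < j \<Longrightarrow> (final, final) \<in> path \<phi> (W j)"
  shows "(initial, final) \<in> path \<phi> (v_pattern n m W)"
proof -
  have A: "(initial, Out k) \<in> path \<phi> (concat (map W [1..<k + 1]))" if "k \<le> n" for k
    using that
  proof (induction k)
    case (Suc k)
    then have "(initial, Out k) \<in> path \<phi> (concat (map W [1..<k + 1]))"
      "(Out k, Out (Suc k)) \<in> path \<phi> (W (Suc k))"
      using up[of "Suc k"] by simp_all
    moreover have "[1..<Suc k + 1] = [1..<k + 1] @ [Suc k]" by simp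
    ultimately show ?case by (auto simp: path_append simp del: upt_Suc)
  qed simp
  have B: "(Out (n + k), Out n) \<in> path \<phi> (concat (map W (rev [1..<k + 1])))" if "k \<le> n" for k
    using that
  proof (induction k)
    case (Suc k)
    then have "(Out (n + k), Out n) \<in> path \<phi> (concat (map W (rev [1..<k + 1])))"
      "(Out (n + Suc k), Out (n + k)) \<in> path \<phi> (W (Suc k))"
      using down[of "Suc k"] by simp_all
    moreover have "rev [1..<Suc k + 1] = Suc k # rev [1..<k + 1]" by simp
    ultimately show ?case by (auto simp: path_append simp del: upt_Suc)
  qed simp
  have C: "(Out n, final) \<in> path \<phi> (concat (map W [n + 1..<n + 2 + k]))" for k
  proof (induction k)
    case 0
    then show ?case using right by (simp add: path_append)
  next
    case (Suc k)
    then have "(final, final) \<in> path \<phi> (W (n + 2 + k))" using loop by simp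
    moreover have "[n + 1..<n + 2 + Suc k] = [n + 1..<n + 2 + k] @ [n + 2 + k]" by simp
    ultimately show ?case using Suc by (auto simp: path_append simp del: upt_Suc)
  qed
  have right': "(Out n, final) \<in> path \<phi> (concat (map W [n + 1..<2 * n + 1]))"
    using C[of "n - 1"] n3 by (simp add: mult_2)
  define U where "U = concat (map W (rev [1..<n + 1])) @ concat (map W [n + 1..<2 * n + 1])"
  have U: "(final, final) \<in> path \<phi> U"
    using B[of n] right' unfolding U_def path_append by (auto simp: mult_2)
  have "(final, final) \<in> path \<phi> (concat (replicate r U))" for r
    by (induction r) (use U in \<open>auto simp: path_append\<close>)
  moreover have "[1..<2 * n + 1] = [1..<n + 1] @ [n + 1..<2 * n + 1]"
    using upt_add_eq_append[of 1 "n + 1" n] by (simp add: mult_2)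
  then have "(initial, final) \<in> path \<phi> (concat (map W [1..<2 * n + 1]))"
    using A[of n] right' by (auto simp: path_append)
  ultimately show ?thesis unfolding v_pattern_def U_def[symmetric] path_append by blast
qed

lemma path_letter_step:
  assumes "(initial, final) \<in> path (letter h) v" "v \<noteq> []"
  shows "(initial, final) \<in> path (letter (Suc h)) (v_pattern n m (\<lambda>j. map (\<lambda>i. i @ [j]) v))"
proof -
  have copy: "(Out (src \<kappa>), Out (tgt \<kappa>)) \<in> path (\<lambda>l. lift i (letter h l)) v" if "label \<kappa> = i" for \<kappa> i
  proof -
    have "(embed \<kappa> initial, embed \<kappa> final) \<in> lift i (path (letter h) v)"
      using assms(1) that unfolding lift_def by blast
    then have "(embed \<kappa> initial, embed \<kappa> final) \<in> path (\<lambda>l. lift i (letter h l)) v"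
      using lift_path_subset[OF assms(2)] by blast
    then show ?thesis using initial_neq_final by (simp add: embed_def)
  qed
  show ?thesis
  proof (rule path_v_pattern)
    fix j assume j: "1 \<le> j" "j \<le> n"
    have lj: "label j = j" "label (n + j) = j" using j by (simp_all add: label_def)
    have "src j = j - 1" "tgt j = j" "src (n + j) = n + j" "tgt (n + j) = n + j - 1"
      using j by (simp_all add: src_def tgt_def)
    then show "(Out (j - 1), Out j) \<in> path (letter (Suc h)) (map (\<lambda>i. i @ [j]) v)"
      "(Out (n + j), Out (n + j - 1)) \<in> path (letter (Suc h)) (map (\<lambda>i. i @ [j]) v)"
      using copy[OF lj(1)] copy[OF lj(2)] j(2) by (simp_all add: path_map)
  next
    have "label 0 = 0" "src 0 = n" "tgt 0 = 2 * n" by (simp_all add: label_def src_def tgt_def)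
    then show "(Out n, final) \<in> path (letter (Suc h)) (map (\<lambda>i. i @ [n + 1]) v)"
      using copy[of 0 0] by (simp add: path_map)
  next
    fix j assume j: "n + 1 < j"
    have "(final, final) \<in> path (\<lambda>_. {(final, final)}) w" for w :: "nat list list"
      by (induction w) auto
    then show "(final, final) \<in> path (letter (Suc h)) (map (\<lambda>i. i @ [j]) v)"
      using j by (simp add: path_map)
  qed
qed

lemma path_v_word:
  "v_word n m (Suc h) \<noteq> [] \<and> (initial, final) \<in> path (letter (Suc h)) (v_word n m (Suc h))"
proof (induction h)
  case 0
  \<comment> \<open>The one-letter word \<open>[[]]\<close> acts as level 0: substituting it into
    the pattern gives \<open>v_word n m (Suc 0)\<close>. Nonemptiness then follows because the empty
    word has value \<open>Id\<close>, which does not move \<open>initial\<close> to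
    \<open>final\<close>.\<close>
  have "(initial, final) \<in> path (letter 0) [[]]" by simp
  from path_letter_step[OF this, of m]
  have "(initial, final) \<in> path (letter (Suc 0)) (v_word n m (Suc 0))" by simp
  then show ?case using initial_neq_final by (metis IdD path.simps(1))
next
  case (Suc h)
  from path_letter_step[OF conjunct2[OF Suc] conjunct1[OF Suc], of m]
  have "(initial, final) \<in> path (letter (Suc (Suc h))) (v_word n m (Suc (Suc h)))"
    by (simp only: v_word.simps)
  then show ?case using initial_neq_final by (metis IdD path.simps(1))
qed

text \<open>If the value \<open>R\<close> were idempotent, its pair from \<open>initial\<close> to
  \<open>final\<close> would factor through some \<open>p\<close>. Single-valuedness gives
  \<open>p = final\<close>, so \<open>R\<close> would be defined at both ends, contrary to
  \<open>tower_initial_final\<close>.\<close>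

lemma v_word_not_idempotent:
  "\<not> reduct_satisfies (rel_algebra (tower (Suc h))) (v_word n m (Suc h))
    (v_word n m (Suc h) @ v_word n m (Suc h))"
proof
  let ?v = "v_word n m (Suc h)" and ?T = "rel_algebra (tower (Suc h))"
  define R where "R = path (letter (Suc h)) ?v"
  have v: "?v \<noteq> []" "(initial, final) \<in> R" using path_v_word by (simp_all add: R_def)
  have letter: "\<forall>l. letter (Suc h) l \<in> carrier ?T"
    unfolding rel_algebra_simps using letter_in_tower by blast
  assume v_eq: "reduct_satisfies ?T ?v (?v @ ?v)"
  from spec[OF v_eq[unfolded reduct_satisfies_def], of "letter (Suc h)"] letter
  have "word_eval ?T (letter (Suc h)) ?v = word_eval ?T (letter (Suc h)) (?v @ ?v)"
    by (rule mp)
  then have "R O R = R" using v(1) by (simp add: word_eval_path path_append R_def)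
  with v(2) have "(initial, final) \<in> R O R" by simp
  then obtain p where p: "(initial, p) \<in> R" "(p, final) \<in> R" by (rule relcompEpair)
  have R: "R \<in> tower (Suc h)"
  proof -
    have "eval ?T (letter (Suc h)) (word_term ?v) \<in> carrier ?T"
      by (rule eval_closed[OF algebra21_tower letter])
    then show ?thesis using v(1) by (simp add: eval_word_term word_eval_path R_def del: tower.simps)
  qed
  have "p = final" using single_valued_tower[OF R] p(1) v(2) by (rule single_valuedD)
  then show False using tower_initial_final[OF R] v(2) p(2) by blast
qed

end

theorem theorem5p1:
  fixes S :: "'a algebra21"
  assumes "involution_semigroup S"
    and "\<exists>q\<ge>1. \<exists>r\<ge>1. \<forall>n\<ge>2. reduct_satisfies S (v_word n q r) (v_word n q r @ v_word n q r)"
    and "identities S \<subseteq> identities B21"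
  shows "\<not> finitely_based TYPE('b::infinite) S"
proof
  assume "finitely_based TYPE('b) S"
  then obtain \<Sigma> where \<Sigma>: "finite \<Sigma>" "is_basis TYPE('b) \<Sigma> S"
    unfolding finitely_based_def by blast
  obtain q r where qr: "1 \<le> r"
    "\<forall>n\<ge>2. reduct_satisfies S (v_word n q r) (v_word n q r @ v_word n q r)"
    using assms(2) by blast
  then obtain h where h: "r = Suc h" by (cases r) auto
  define k where "k e = card (set_uterm (fst e) \<union> set_uterm (snd e))" for e :: "nat identity"
  \<comment> \<open>The sum bounds each summand, so one \<open>n\<close> serves the whole finite
    basis. The constant 3 secures both \<open>3 \<le> n\<close> and the strict bound in
    \<open>tower_identity\<close>.\<close>
  define n where "n = 2 * (\<Sum>e\<in>\<Sigma>. k e) + 3"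
  interpret iterated_graph n by unfold_locales (simp add: n_def)
  let ?T = "rel_algebra (tower r)"
  have \<Sigma>_S: "\<Sigma> \<subseteq> identities S" using \<Sigma>(2) by (simp add: is_basis_def)
  have "\<Sigma> \<subseteq> identities ?T"
  proof
    fix e assume e: "e \<in> \<Sigma>"
    then have "k e \<le> (\<Sum>e\<in>\<Sigma>. k e)" using \<Sigma>(1) by (intro member_le_sum) simp_all
    then have "2 * k e + 2 < n" by (simp add: n_def)
    moreover have "e \<in> identities B21" using e \<Sigma>_S assms(3) by auto
    ultimately show "e \<in> identities ?T" by (simp only: k_def tower_identity)
  qed
  \<comment> \<open>The tower lives on a type of its own, unrelated to the type on which the basis
    is tested.\<close>
  with is_basis_universal[OF \<Sigma>(2) algebra21_tower] have T: "identities S \<subseteq> identities ?T" .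
  have "reduct_satisfies S (v_word n q r) (v_word n q r @ v_word n q r)"
    using qr(2) by (simp add: n_def)
  moreover have v: "v_word n q r \<noteq> []" using path_v_word[of q h] unfolding h by (rule conjunct1)
  moreover have "v_word n q r @ v_word n q r \<noteq> []" using v by simp
  ultimately have "reduct_satisfies ?T (v_word n q r) (v_word n q r @ v_word n q r)"
    using T reduct_satisfies_transfer by metis
  then show False using v_word_not_idempotent[of h q] unfolding h by (rule notE[rotated])
qed

end
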